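(* Let $b>0$ be real and let $q\ge2$ be an integer. The Gabor system $\mathcal{G}(B_2,1/(qb),b)$ is a frame for $L^2(\mathbb{R})$ if and only if one of the following holds: - $R(b)=1$; or - $R(b)\in\{0,2,3,4,\dots\}$ and $|F(b)|>\dfrac{1}{2q}$.
   Context: The hat spline is $B_2=B_1*B_1$ with $B_1=\chi_{[-1/2,1/2)}$, i.e. $B_2(x)=\max(0,1-|x|)$. For $g\in L^2(\mathbb{R})$ and $a,b>0$ the Gabor system is the family $\mathcal{G}(g,a,b)=\{e^{2\pi i b k\,\cdot}\,g(\cdot-am)\}_{k,m\in\mathbb{Z}}$. For $t\in\mathbb{R}$, $R(t)=\lfloor t+\tfrac12\rfloor$ denotes rounding to the nearest integer and $F(t)=t-R(t)\in[-\tfrac12,\tfrac12)$ denotes the signed fractional part. *)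

theory Defs
  imports "HOL-Analysis.Analysis"
begin

text \<open>
  Elements of \<open>L\<^sup>2(\<real>)\<close> are represented by square-integrable Borel functions rather than by their
  almost-everywhere classes; all notions below are insensitive to the choice of representative.
\<close>

definition L2 :: "(real \<Rightarrow> complex) set" where
  "L2 = {f. f \<in> borel_measurable lborel \<and> integrable lborel (\<lambda>x. (norm (f x))\<^sup>2)}"

definition L2_inner :: "(real \<Rightarrow> complex) \<Rightarrow> (real \<Rightarrow> complex) \<Rightarrow> complex" where
  "L2_inner f g = (LINT x|lborel. f x * cnj (g x))"

definition L2_norm :: "(real \<Rightarrow> complex) \<Rightarrow> real" where
  "L2_norm f = sqrt (LINT x|lborel. (norm (f x))\<^sup>2)"

text \<open>
  Summability is part of the definition because \<open>infsum\<close> is \<open>0\<close> for families that are not summable.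
\<close>

definition L2_frame :: "('i \<Rightarrow> real \<Rightarrow> complex) \<Rightarrow> bool" where
  "L2_frame \<phi> \<longleftrightarrow> (\<forall>i. \<phi> i \<in> L2) \<and>
     (\<exists>A>0. \<exists>B>0. \<forall>f\<in>L2.
        (\<lambda>i. (norm (L2_inner f (\<phi> i)))\<^sup>2) summable_on UNIV \<and>
        A * (L2_norm f)\<^sup>2 \<le> (\<Sum>\<^sub>\<infinity>i. (norm (L2_inner f (\<phi> i)))\<^sup>2) \<and>
        (\<Sum>\<^sub>\<infinity>i. (norm (L2_inner f (\<phi> i)))\<^sup>2) \<le> B * (L2_norm f)\<^sup>2)"

definition gabor_system :: "(real \<Rightarrow> complex) \<Rightarrow> real \<Rightarrow> real \<Rightarrow> int \<times> int \<Rightarrow> real \<Rightarrow> complex" where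
  "gabor_system g a b = (\<lambda>(k, m) x.
     exp (2 * of_real pi * \<i> * of_real b * of_int k * of_real x) * g (x - a * of_int m))"

definition convolve :: "(real \<Rightarrow> real) \<Rightarrow> (real \<Rightarrow> real) \<Rightarrow> real \<Rightarrow> real" where
  "convolve f g x = (LINT y|lborel. f y * g (x - y))"

definition B1 :: "real \<Rightarrow> real" where
  "B1 = indicat_real {-1/2..<1/2}"

definition B2 :: "real \<Rightarrow> real" where
  "B2 = convolve B1 B1"

lemma B2_eq: "B2 x = max 0 (1 - \<bar>x\<bar>)"
proof (cases "x \<ge> 0")
  case True
  then have "(\<lambda>y. B1 y * B1 (x - y)) = indicat_real {x - 1/2<..<1/2}"
    by (auto simp: B1_def indicator_def fun_eq_iff)
  then show ?thesis
    using True by (simp add: B2_def convolve_def max_def)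
next
  case False
  then have "(\<lambda>y. B1 y * B1 (x - y)) = indicat_real {-1/2..x + 1/2}"
    by (auto simp: B1_def indicator_def fun_eq_iff)
  then show ?thesis
    using False by (simp add: B2_def convolve_def max_def)
qed

text \<open>
  Rounding to the nearest integer is the library's \<open>round\<close>, with \<open>round t = \<lfloor>t + 1/2\<rfloor>\<close>.
\<close>

definition signed_frac :: "real \<Rightarrow> real" where
  "signed_frac t = t - of_int (round t)"

end

theory Submission
  imports Defs
begin

text \<open>
  A dilation by \<open>b\<close> turns the system into \<open>G(g, 1/q, 1)\<close> with the tent \<open>g(y) = B\<^sub>2(y/b)\<close>. The proof
  has an analytic half, valid for every continuous compactly supported real window \<open>g\<close>, and a
  computation for the tent.

  The analytic half is the criterion \<open>frame_iff_zak_nonvanishing\<close>: the system is a frame iff the Zak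
  transform \<open>Z(y, t) = \<Sum>\<^sub>k g(y + k) exp(2\<pi>ikt)\<close> has no zero common to a whole coset \<open>y + \<int>/q\<close>.
  The frame coefficients with translation index \<open>m\<close> are the Fourier coefficients of the periodization of
  \<open>f \<sqdot> g(\<sqdot> - m/q)\<close>, so Parseval turns their energy into an integral over one period of
  \<open>\<Sum>\<^sub>m |\<Sum>\<^sub>n f(x + n) g(x + n - m/q)|\<^sup>2\<close>. Sorting \<open>m\<close> by its residue modulo \<open>q\<close> exhibits the inner sums as \<open>q\<close>
  convolutions in \<open>n\<close>, and a second Fourier series in \<open>n\<close> makes them multiplications by the values of
  \<open>Z\<close> on the coset (\<open>correlation_lower_bound\<close>). If these have no common zero, compactness gives a
  uniform lower bound. It is first established for continuous \<open>f\<close> of compact support, where only finitely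
  many \<open>m\<close> occur and Parseval follows from the Stone-Weierstrass theorem, and extended by density,
  the upper bound being a consequence of Bessel's inequality. Conversely, at a common zero a long
  train of short bumps with matching phases has arbitrarily small relative energy.

  For the tent, fix \<open>z = exp(2\<pi>it)\<close>. If \<open>z = 1\<close>, then \<open>Z\<close> is a sum of non-negative terms. If
  \<open>z \<noteq> 1\<close>, then \<open>Z(\<sqdot>, t)\<close> is a quasi-periodic piecewise linear function, determined by its kinks: at
  integers, and at distance \<open>\<delta> = |F(b)|\<close> from them with weights \<open>w\<close> and \<open>1/w\<close> where
  \<open>w = z\<^bsup>\<plusminus>R(b)\<^esup>\<close>. If \<open>w = 1\<close>, which for some \<open>z \<noteq> 1\<close> happens precisely when \<open>R(b) \<noteq> 1\<close>, what remains
  of \<open>Z\<close> on a period is a single tent of half-width \<open>\<delta>\<close>, and every coset of \<open>\<int>/q\<close> meets its interior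
  iff \<open>2\<delta> > 1/q\<close>. If \<open>w \<noteq> 1\<close>, then all zeros are half-integers and \<open>0\<close>, \<open>1/2\<close> are not both
  zeros, so no coset consists of zeros.
\<close>

section \<open>Fourier series on an interval of length one\<close>

definition fchar :: "int \<Rightarrow> real \<Rightarrow> complex" where
  "fchar k t = cis (2 * pi * of_int k * t)"

lemma fchar_0 [simp]: "fchar 0 t = 1"
  by (simp add: fchar_def)

lemma norm_fchar [simp]: "norm (fchar k t) = 1"
  by (simp add: fchar_def)

lemma fchar_nonzero [simp]: "fchar k t \<noteq> 0"
  by (metis norm_fchar norm_zero zero_neq_one)

lemma fchar_add: "fchar (j + k) t = fchar j t * fchar k t"
  by (simp add: fchar_def cis_mult algebra_simps)

lemma fchar_minus: "fchar (- k) t = cnj (fchar k t)"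
  by (simp add: fchar_def cis_cnj)

lemma fchar_uminus: "fchar k (- t) = cnj (fchar k t)"
  by (simp add: fchar_def cis_cnj)

lemma cis_2pi_int: "cis (2 * pi * of_int n) = 1"
  by (rule cis_multiple_2pi) auto

lemma fchar_add_int [simp]: "fchar k (t + of_int n) = fchar k t"
proof -
  have "fchar k (t + of_int n) = fchar k t * cis (2 * pi * of_int (k * n))"
    by (simp add: fchar_def cis_mult algebra_simps)
  then show ?thesis by (simp add: cis_2pi_int del: of_int_mult)
qed

lemma fchar_of_int [simp]: "fchar k (of_int n) = 1"
  using fchar_add_int[of k 0 n] by (simp add: fchar_def)

lemma fchar_powi: "fchar k t = fchar 1 t powi k"
  by (simp add: fchar_def cis_power_int mult_ac)

lemma continuous_on_fchar [continuous_intros]: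
  assumes "continuous_on S f"
  shows "continuous_on S (\<lambda>x. fchar k (f x))"
  unfolding fchar_def cis_conv_exp using assms by (auto intro!: continuous_intros)

lemma borel_measurable_fchar [measurable]: "fchar k \<in> borel_measurable borel"
  by (intro borel_measurable_continuous_onI continuous_intros)

text \<open>
  All Fourier analysis takes place on a half-open interval of length one with an arbitrary left end;
  as a measure space it is a probability space on which the characters are orthonormal.
\<close>

definition unit_interval :: "real \<Rightarrow> real measure" where
  "unit_interval s = restrict_space lborel {s..<s+1}"

lemma space_unit_interval [simp]: "space (unit_interval s) = {s..<s+1}"
  by (simp add: unit_interval_def)

lemma emeasure_unit_interval: "emeasure (unit_interval s) (space (unit_interval s)) = 1"
  by (simp add: unit_interval_def emeasure_restrict_space)

lemma finite_measure_unit_interval: "finite_measure (unit_interval s)"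
  by (rule finite_measureI) (simp add: emeasure_unit_interval del: space_unit_interval)

lemma measurable_unit_interval:
  "f \<in> borel_measurable borel \<Longrightarrow> f \<in> borel_measurable (unit_interval s)"
  unfolding unit_interval_def by (rule measurable_restrict_space1) simp

lemma integrable_unit_interval_bounded:
  fixes f :: "real \<Rightarrow> 'b::{banach, second_countable_topology}"
  assumes "f \<in> borel_measurable (unit_interval s)"
    and "\<And>x. s \<le> x \<Longrightarrow> x < s + 1 \<Longrightarrow> norm (f x) \<le> C"
  shows "integrable (unit_interval s) f"
  by (rule finite_measure.integrable_const_bound[OF finite_measure_unit_interval _ assms(1), of C])
     (use assms(2) in auto)

lemma integral_unit_interval_bound:
  fixes f :: "real \<Rightarrow> real"
  assumes "\<And>x. s \<le> x \<Longrightarrow> x < s + 1 \<Longrightarrow> f x \<le> C" "0 \<le> C"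
  shows "(\<integral>x. f x \<partial>unit_interval s) \<le> C"
proof (cases "integrable (unit_interval s) f")
  case True
  have "(\<integral>x. f x \<partial>unit_interval s) \<le> (\<integral>x. C \<partial>unit_interval s)"
    by (rule integral_mono)
      (use True assms finite_measure.integrable_const[OF finite_measure_unit_interval] in auto)
  then show ?thesis
    using emeasure_unit_interval[of s] by (simp add: measure_def)
qed (use assms in \<open>simp add: not_integrable_integral_eq\<close>)

lemma integral_unit_interval_const [simp]:
  "(\<integral>x. c \<partial>unit_interval s) = (c::'b::{banach, second_countable_topology})"
  using emeasure_unit_interval[of s] by (simp add: measure_def)

lemma integral_initial_segment:
  assumes "0 < \<epsilon>" "\<epsilon> \<le> 1"
  shows "(\<integral>x. indicator {s..<s + \<epsilon>} x \<partial>unit_interval s) = (\<epsilon> :: real)"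
    "integrable (unit_interval s) (indicator {s..<s + \<epsilon>} :: real \<Rightarrow> real)"
proof -
  have "(\<integral>x. indicator {s..<s + \<epsilon>} x \<partial>unit_interval s) = (\<integral>x. indicator {s..<s + 1} x *\<^sub>R indicator {s..<s + \<epsilon>} x \<partial>lborel :: real)"
    unfolding unit_interval_def by (subst integral_restrict_space) auto
  also have "\<dots> = (\<integral>x. indicator {s..<s + \<epsilon>} x \<partial>lborel)"
    by (rule Bochner_Integration.integral_cong) (use assms in \<open>auto simp: indicator_def\<close>)
  also have "\<dots> = \<epsilon>" using assms by simp
  finally show "(\<integral>x. indicator {s..<s + \<epsilon>} x \<partial>unit_interval s) = (\<epsilon> :: real)" .
  show "integrable (unit_interval s) (indicator {s..<s + \<epsilon>} :: real \<Rightarrow> real)"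
    by (rule integrable_unit_interval_bounded[where C = 1])
      (auto simp: indicator_def intro!: measurable_unit_interval)
qed

lemma integrable_fchar [simp]: "integrable (unit_interval s) (fchar k)"
  by (rule integrable_unit_interval_bounded[where C = 1])
    (auto intro: measurable_unit_interval borel_measurable_fchar)

lemma integral_fchar: "(\<integral>x. fchar k x \<partial>unit_interval s) = (if k = 0 then 1 else 0)"
proof (cases "k = 0")
  case False
  define F where "F x = fchar k x / (2 * pi * \<i> * of_int k)" for x
  have "(\<integral>x. fchar k x \<partial>unit_interval s) = (\<integral>x. indicator {s..<s+1} x *\<^sub>R fchar k x \<partial>lborel)"
    unfolding unit_interval_def by (subst integral_restrict_space) auto
  also have "\<dots> = (\<integral>x. indicator {s..s+1} x *\<^sub>R fchar k x \<partial>lborel)"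
    by (intro integral_cong_AE) (auto simp: indicator_def intro!: eventually_mono[OF AE_lborel_singleton[of "s+1"]])
  also have "\<dots> = F (s+1) - F s"
  proof (rule integral_FTC_atLeastAtMost)
    fix x assume "s \<le> x" "x \<le> s + 1"
    have "((\<lambda>x. exp (x *\<^sub>R (2 * pi * \<i> * of_int k)) / (2 * pi * \<i> * of_int k)) has_vector_derivative
        exp (x *\<^sub>R (2 * pi * \<i> * of_int k)) * (2 * pi * \<i> * of_int k) / (2 * pi * \<i> * of_int k)) (at x within {s..s+1})"
      by (intro has_vector_derivative_divide exp_scaleR_has_vector_derivative_right)
    then show "(F has_vector_derivative fchar k x) (at x within {s..s+1})"
      using False by (simp add: F_def[abs_def] fchar_def cis_conv_exp scaleR_conv_of_real mult_ac)
  qed (auto intro!: continuous_intros)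
  also have "\<dots> = 0"
    using fchar_add_int[of k s 1] by (simp add: F_def)
  finally show ?thesis using False by simp
qed (use emeasure_unit_interval[of s] in \<open>simp add: measure_def\<close>)

lemma integrable_of_square_integrable:
  fixes H :: "real \<Rightarrow> complex"
  assumes "H \<in> borel_measurable (unit_interval s)" "integrable (unit_interval s) (\<lambda>x. (norm (H x))\<^sup>2)"
  shows "integrable (unit_interval s) H"
proof (rule Bochner_Integration.integrable_bound)
  show "integrable (unit_interval s) (\<lambda>x. 1 + (norm (H x))\<^sup>2)"
    by (intro Bochner_Integration.integrable_add assms(2) finite_measure.integrable_const finite_measure_unit_interval)
  have "norm (H x) \<le> 1 + (norm (H x))\<^sup>2" for x
    using zero_le_power2[of "norm (H x) - 1/2"] by (simp add: power2_eq_square algebra_simps)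
  then show "AE x in unit_interval s. norm (H x) \<le> norm (1 + (norm (H x))\<^sup>2)"
    by (simp add: order_trans)
qed (rule assms(1))

lemma borel_measurable_fchar_unit_interval [measurable]: "fchar k \<in> borel_measurable (unit_interval s)"
  by (intro measurable_unit_interval borel_measurable_fchar)

definition fcoeff :: "real \<Rightarrow> (real \<Rightarrow> complex) \<Rightarrow> int \<Rightarrow> complex" where
  "fcoeff s H k = (\<integral>x. H x * fchar (- k) x \<partial>unit_interval s)"

text \<open>
  Expanding the square and using orthonormality gives the distance from a function to any
  trigonometric polynomial. Dropping the left-hand side (with \<open>d\<close> the Fourier coefficients) yields
  Bessel's inequality; dropping the last sum bounds the energy missed by a finite set of frequencies.
\<close>

lemma trig_poly_distance:
  fixes H :: "real \<Rightarrow> complex"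
  assumes [measurable]: "H \<in> borel_measurable (unit_interval s)"
    and sq: "integrable (unit_interval s) (\<lambda>x. (norm (H x))\<^sup>2)" and K: "finite K"
  shows "(\<integral>x. (norm (H x - (\<Sum>k\<in>K. d k * fchar k x)))\<^sup>2 \<partial>unit_interval s) =
    (\<integral>x. (norm (H x))\<^sup>2 \<partial>unit_interval s) - (\<Sum>k\<in>K. (norm (fcoeff s H k))\<^sup>2) +
    (\<Sum>k\<in>K. (norm (fcoeff s H k - d k))\<^sup>2)"
proof -
  let ?M = "unit_interval s"
  let ?c = "fcoeff s H"
  note int_H = integrable_of_square_integrable[OF assms(1,2)]
  have int_Hf: "integrable ?M (\<lambda>x. H x * fchar k x)" for k
    by (rule Bochner_Integration.integrable_bound[OF int_H]) (auto simp: norm_mult)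
  have [measurable]: "(\<lambda>x. cnj (H x)) \<in> borel_measurable ?M"
    by (rule borel_measurable_continuous_on[OF _ assms(1)]) (intro continuous_intros)
  have int_Hf': "integrable ?M (\<lambda>x. cnj (H x) * fchar k x)" for k
    by (rule Bochner_Integration.integrable_bound[OF int_H]) (auto simp: norm_mult)
  have c': "(\<integral>x. cnj (H x) * fchar k x \<partial>?M) = cnj (?c k)" for k
  proof -
    have "cnj (?c k) = (\<integral>x. cnj (H x * fchar (- k) x) \<partial>?M)"
      by (simp add: fcoeff_def del: complex_cnj_mult)
    then show ?thesis by (simp add: fchar_minus)
  qed
  have expand: "complex_of_real ((norm (H x - (\<Sum>k\<in>K. d k * fchar k x)))\<^sup>2) =
      of_real ((norm (H x))\<^sup>2) - (\<Sum>k\<in>K. cnj (d k) * (H x * fchar (- k) x))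
       - (\<Sum>k\<in>K. d k * (cnj (H x) * fchar k x))
       + (\<Sum>j\<in>K. \<Sum>k\<in>K. d j * cnj (d k) * fchar (j - k) x)" for x
  proof -
    have "fchar (j - k) x = fchar j x * cnj (fchar k x)" for j k
      using fchar_add[of j "-k" x] by (simp add: fchar_minus)
    then have 1: "(\<Sum>j\<in>K. \<Sum>k\<in>K. d j * cnj (d k) * fchar (j - k) x) =
        (\<Sum>j\<in>K. d j * fchar j x) * cnj (\<Sum>k\<in>K. d k * fchar k x)"
      by (simp add: cnj_sum sum_product algebra_simps)
    have 2: "(\<Sum>k\<in>K. cnj (d k) * (H x * fchar (- k) x)) = H x * cnj (\<Sum>k\<in>K. d k * fchar k x)"
      by (simp add: cnj_sum sum_distrib_left fchar_minus algebra_simps)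
    have 3: "(\<Sum>k\<in>K. d k * (cnj (H x) * fchar k x)) = cnj (H x) * (\<Sum>k\<in>K. d k * fchar k x)"
      by (simp add: sum_distrib_left algebra_simps)
    show ?thesis
      unfolding 1 2 3 complex_norm_square by (simp add: algebra_simps)
  qed
  have "complex_of_real (\<integral>x. (norm (H x - (\<Sum>k\<in>K. d k * fchar k x)))\<^sup>2 \<partial>?M) =
     (\<integral>x. complex_of_real ((norm (H x - (\<Sum>k\<in>K. d k * fchar k x)))\<^sup>2) \<partial>?M)"
    by (rule integral_complex_of_real[symmetric])
  also have "\<dots> = (\<integral>x. of_real ((norm (H x))\<^sup>2) \<partial>?M) - (\<Sum>k\<in>K. cnj (d k) * ?c k)
       - (\<Sum>k\<in>K. d k * cnj (?c k)) + (\<Sum>j\<in>K. \<Sum>k\<in>K. d j * cnj (d k) * (if j = k then 1 else 0))"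
  proof -
    have "integrable ?M (\<lambda>x. complex_of_real ((norm (H x))\<^sup>2))"
      using sq by (rule integrable_of_real)
    then show ?thesis
      unfolding expand
      by (simp add: int_Hf int_Hf' Bochner_Integration.integral_add Bochner_Integration.integral_diff
          Bochner_Integration.integral_sum c' integral_fchar del: of_real_power flip: fcoeff_def)
  qed
  also have "\<dots> = of_real ((\<integral>x. (norm (H x))\<^sup>2 \<partial>?M) - (\<Sum>k\<in>K. (norm (?c k))\<^sup>2) + (\<Sum>k\<in>K. (norm (?c k - d k))\<^sup>2))"
  proof -
    have "(\<Sum>j\<in>K. \<Sum>k\<in>K. d j * cnj (d k) * (if j = k then 1 else 0)) = (\<Sum>k\<in>K. d k * cnj (d k))"
      using K by (simp add: sum.delta' if_distrib cong: if_cong)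
    then show ?thesis
      unfolding integral_complex_of_real of_real_add of_real_diff of_real_sum
      by (simp only: complex_norm_square) (simp add: sum.distrib sum_subtractf algebra_simps)
  qed
  finally show ?thesis by (simp only: of_real_eq_iff)
qed

lemma trig_poly_norm:
  assumes "finite K"
  shows "(\<integral>x. (norm (\<Sum>k\<in>K. d k * fchar k x))\<^sup>2 \<partial>unit_interval s) = (\<Sum>k\<in>K. (norm (d k))\<^sup>2)"
  using trig_poly_distance[of "\<lambda>_. 0" s K d] assms by (simp add: fcoeff_def)

lemma bessel_inequality:
  assumes "H \<in> borel_measurable (unit_interval s)"
    and "integrable (unit_interval s) (\<lambda>x. (norm (H x))\<^sup>2)" and "finite K"
  shows "(\<Sum>k\<in>K. (norm (fcoeff s H k))\<^sup>2) \<le> (\<integral>x. (norm (H x))\<^sup>2 \<partial>unit_interval s)"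
proof -
  have "0 \<le> (\<integral>x. (norm (H x - (\<Sum>k\<in>K. fcoeff s H k * fchar k x)))\<^sup>2 \<partial>unit_interval s)"
    by simp
  then show ?thesis by (subst (asm) trig_poly_distance) (use assms in auto)
qed

definition trig_poly :: "(real \<Rightarrow> complex) \<Rightarrow> bool" where
  "trig_poly P \<longleftrightarrow> (\<exists>K d. finite K \<and> (\<forall>x. P x = (\<Sum>k\<in>K. d k * fchar k x)))"

lemma trig_poly_monomial: "trig_poly (\<lambda>x. c * fchar k x)"
  unfolding trig_poly_def by (rule exI[of _ "{k}"]) auto

lemma trig_poly_const: "trig_poly (\<lambda>x. c)"
  using trig_poly_monomial[of c 0] by simp

lemma trig_poly_add:
  assumes "trig_poly P" "trig_poly Q"
  shows "trig_poly (\<lambda>x. P x + Q x)"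
proof -
  obtain K d L e where K: "finite K" "\<And>x. P x = (\<Sum>k\<in>K. d k * fchar k x)"
    and L: "finite L" "\<And>x. Q x = (\<Sum>k\<in>L. e k * fchar k x)"
    using assms unfolding trig_poly_def by blast
  have 1: "P x = (\<Sum>k\<in>K \<union> L. (if k \<in> K then d k else 0) * fchar k x)" for x
    unfolding K(2) by (rule sum.mono_neutral_cong_left) (use K L in auto)
  have 2: "Q x = (\<Sum>k\<in>K \<union> L. (if k \<in> L then e k else 0) * fchar k x)" for x
    unfolding L(2) by (rule sum.mono_neutral_cong_left) (use K L in auto)
  show ?thesis
    unfolding trig_poly_def
    by (rule exI[of _ "K \<union> L"], rule exI[of _ "\<lambda>k. (if k \<in> K then d k else 0) + (if k \<in> L then e k else 0)"])
      (use K(1) L(1) in \<open>simp add: 1 2 sum.distrib distrib_right\<close>)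
qed

lemma trig_poly_sum:
  "finite K \<Longrightarrow> (\<And>k. k \<in> K \<Longrightarrow> trig_poly (P k)) \<Longrightarrow> trig_poly (\<lambda>x. \<Sum>k\<in>K. P k x)"
  by (induction K rule: finite_induct) (auto intro: trig_poly_const trig_poly_add)

lemma trig_poly_mult:
  assumes "trig_poly P" "trig_poly Q"
  shows "trig_poly (\<lambda>x. P x * Q x)"
proof -
  obtain K d L e where K: "finite K" "\<And>x. P x = (\<Sum>k\<in>K. d k * fchar k x)"
    and L: "finite L" "\<And>x. Q x = (\<Sum>k\<in>L. e k * fchar k x)"
    using assms unfolding trig_poly_def by blast
  have "P x * Q x = (\<Sum>j\<in>K. \<Sum>k\<in>L. (d j * e k) * fchar (j + k) x)" for x
    by (simp add: K L sum_product fchar_add mult_ac)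
  then show ?thesis
    using K L by (simp add: trig_poly_sum trig_poly_monomial)
qed

lemma trig_poly_of_real_polynomial:
  "real_polynomial_function p \<Longrightarrow> trig_poly (\<lambda>x. of_real (p (fchar 1 x)))"
proof (induction rule: real_polynomial_function.induct)
  case (linear f)
  have f: "f z = Re z * f 1 + Im z * f \<i>" for z
  proof -
    have "f z = f (Re z *\<^sub>R 1 + Im z *\<^sub>R \<i>)"
      by (metis complex_eq scaleR_conv_of_real mult.commute mult.right_neutral)
    also have "\<dots> = Re z * f 1 + Im z * f \<i>"
      using linear by (simp add: linear_simps)
    finally show ?thesis .
  qed
  have re: "of_real (Re (fchar 1 x)) = 1/2 * fchar 1 x + 1/2 * fchar (-1) x" for x
    by (simp add: fchar_minus complex_eq_iff)
  have im: "of_real (Im (fchar 1 x)) = (- \<i>/2) * fchar 1 x + (\<i>/2) * fchar (-1) x" for x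
    by (simp add: fchar_minus complex_eq_iff)
  have "of_real (f (fchar 1 x)) =
     (1/2 * fchar 1 x + 1/2 * fchar (-1) x) * of_real (f 1) +
     ((- \<i>/2) * fchar 1 x + (\<i>/2) * fchar (-1) x) * of_real (f \<i>)" for x
    unfolding f[of "fchar 1 x"] of_real_add of_real_mult re im by (rule refl)
  then show ?case
    by (simp only:) (intro trig_poly_add trig_poly_monomial trig_poly_const trig_poly_mult)
qed (simp_all add: trig_poly_const trig_poly_add trig_poly_mult)

text \<open>
  A function with equal values at both ends of \<open>[0, 1]\<close> is a function on the unit circle, and there
  real polynomials in the two coordinates are trigonometric polynomials.
\<close>

lemma trig_poly_dense:
  fixes H :: "real \<Rightarrow> complex"
  assumes "continuous_on {0..1} H" "H 0 = H 1" "\<epsilon> > 0"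
  obtains P where "trig_poly P" "\<And>x. 0 \<le> x \<Longrightarrow> x \<le> 1 \<Longrightarrow> norm (H x - P x) < \<epsilon>"
proof -
  define \<phi> where "\<phi> = H \<circ> (\<lambda>z. Arg2pi z / (2*pi))"
  have "homotopic_loops UNIV H H"
    by (simp add: homotopic_loops_refl path_def pathfinish_def pathstart_def assms)
  from homotopic_with_imp_continuous[OF homotopic_loops_imp_homotopic_circlemaps[OF this]]
  have "continuous_on (sphere 0 1) \<phi>"
    by (simp add: \<phi>_def)
  from Stone_Weierstrass_polynomial_function[OF compact_sphere this \<open>\<epsilon> > 0\<close>]
  obtain g where g: "polynomial_function g" "\<And>z. norm z = 1 \<Longrightarrow> norm (\<phi> z - g z) < \<epsilon>"
    by auto
  have "real_polynomial_function (Re \<circ> g)" "real_polynomial_function (Im \<circ> g)"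
    using g(1) by (auto simp: polynomial_function_def bounded_linear_Re bounded_linear_Im)
  note parts = this[THEN trig_poly_of_real_polynomial]
  have "trig_poly (\<lambda>x. of_real ((Re \<circ> g) (fchar 1 x)) + \<i> * of_real ((Im \<circ> g) (fchar 1 x)))"
    by (rule trig_poly_add[OF parts(1) trig_poly_mult[OF trig_poly_const parts(2)]])
  then have "trig_poly (\<lambda>x. g (fchar 1 x))"
    unfolding o_def complex_eq[symmetric] .
  moreover have "norm (H x - g (fchar 1 x)) < \<epsilon>" if "0 \<le> x" "x \<le> 1" for x
  proof -
    have "\<phi> (fchar 1 x) = H x"
    proof (cases "x = 1")
      case True
      then show ?thesis
        using fchar_of_int[of 1 1] assms(2) by (simp add: \<phi>_def Arg2pi_of_real[of 1, simplified])
    next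
      case False
      have "Arg2pi (fchar 1 x) = 2 * pi * x"
        by (rule Arg2pi_unique[of 1]) (use that False in \<open>auto simp: fchar_def cis_conv_exp\<close>)
      then show ?thesis by (simp add: \<phi>_def)
    qed
    then show ?thesis using g(2)[of "fchar 1 x"] by simp
  qed
  ultimately show thesis by (rule that)
qed

text \<open>
  By the distance formula with uniformly good trigonometric approximants, the energies of the
  Fourier coefficients of finitely many continuous functions are exhausted by a common finite set
  of frequencies.
\<close>

lemma parseval_approx:
  fixes H :: "'i \<Rightarrow> real \<Rightarrow> complex"
  assumes "finite I" and "\<And>i. i \<in> I \<Longrightarrow> continuous_on {0..1} (H i)" "\<And>i. i \<in> I \<Longrightarrow> H i 0 = H i 1"
    and "\<epsilon> > 0"
  obtains K where "finite K"
    "\<And>i. i \<in> I \<Longrightarrow> (\<integral>x. (norm (H i x))\<^sup>2 \<partial>unit_interval 0) \<le> (\<Sum>k\<in>K. (norm (fcoeff 0 (H i) k))\<^sup>2) + \<epsilon>"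
proof -
  have "\<exists>K. finite K \<and> (\<integral>x. (norm (H i x))\<^sup>2 \<partial>unit_interval 0) \<le> (\<Sum>k\<in>K. (norm (fcoeff 0 (H i) k))\<^sup>2) + \<epsilon>"
    if i: "i \<in> I" for i
  proof -
    obtain P where P: "trig_poly P" "\<And>x. 0 \<le> x \<Longrightarrow> x \<le> 1 \<Longrightarrow> norm (H i x - P x) < sqrt \<epsilon>"
      by (rule trig_poly_dense[OF assms(2)[OF i] assms(3)[OF i] real_sqrt_gt_zero[OF assms(4)]]) blast
    from P(1) obtain K d where K: "finite K" "\<And>x. P x = (\<Sum>k\<in>K. d k * fchar k x)"
      unfolding trig_poly_def by blast
    have "bounded (H i ` {0..1})"
      by (intro compact_imp_bounded compact_continuous_image assms(2) i compact_Icc)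
    then obtain C where "\<forall>y\<in>H i ` {0..1}. norm y \<le> C"
      unfolding bounded_iff by blast
    then have C: "norm (H i x) \<le> C" if "0 \<le> x" "x \<le> 1" for x
      using that by simp
    have "continuous_on {0..<1} (H i)"
      using assms(2)[OF i] by (rule continuous_on_subset) auto
    then have "H i \<in> borel_measurable (restrict_space borel {0..<1})"
      by (rule borel_measurable_continuous_on_restrict)
    moreover have "sets (unit_interval 0) = sets (restrict_space borel {0..<1})"
      unfolding unit_interval_def by (simp add: sets_restrict_space)
    ultimately have meas: "H i \<in> borel_measurable (unit_interval 0)"
      using measurable_cong_sets by blast
    have "integrable (unit_interval 0) (\<lambda>x. (norm (H i x))\<^sup>2)"
      by (rule integrable_unit_interval_bounded[where C = "C\<^sup>2"])
        (use meas C in \<open>auto intro: power_mono simp del: power_mono_iff\<close>)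
    from trig_poly_distance[OF meas this K(1), of d]
    have "(\<integral>x. (norm (H i x))\<^sup>2 \<partial>unit_interval 0) \<le>
       (\<Sum>k\<in>K. (norm (fcoeff 0 (H i) k))\<^sup>2) + (\<integral>x. (norm (H i x - P x))\<^sup>2 \<partial>unit_interval 0)"
      using sum_nonneg[of K "\<lambda>k. (norm (fcoeff 0 (H i) k - d k))\<^sup>2"] by (simp add: K(2))
    also have "(\<integral>x. (norm (H i x - P x))\<^sup>2 \<partial>unit_interval 0) \<le> \<epsilon>"
    proof (rule integral_unit_interval_bound)
      fix x :: real assume "0 \<le> x" "x < 0 + 1"
      then have "norm (H i x - P x) \<le> sqrt \<epsilon>"
        using P(2)[of x] by simp
      then have "(norm (H i x - P x))\<^sup>2 \<le> (sqrt \<epsilon>)\<^sup>2"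
        by (rule power_mono) simp
      then show "(norm (H i x - P x))\<^sup>2 \<le> \<epsilon>" using \<open>\<epsilon> > 0\<close> by simp
    qed (use \<open>\<epsilon> > 0\<close> in simp)
    finally show ?thesis using K(1) by (intro exI[of _ K]) simp
  qed
  then have "\<forall>i\<in>I. \<exists>K. finite K \<and>
     (\<integral>x. (norm (H i x))\<^sup>2 \<partial>unit_interval 0) \<le> (\<Sum>k\<in>K. (norm (fcoeff 0 (H i) k))\<^sup>2) + \<epsilon>"
    by blast
  from bchoice[OF this] obtain K where K: "\<And>i. i \<in> I \<Longrightarrow> finite (K i)"
    "\<And>i. i \<in> I \<Longrightarrow> (\<integral>x. (norm (H i x))\<^sup>2 \<partial>unit_interval 0) \<le> (\<Sum>k\<in>K i. (norm (fcoeff 0 (H i) k))\<^sup>2) + \<epsilon>"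
    by blast
  show thesis
  proof (rule that)
    show fin: "finite (\<Union>i\<in>I. K i)" by (intro finite_UN_I assms(1) K(1))
    show "(\<integral>x. (norm (H i x))\<^sup>2 \<partial>unit_interval 0) \<le> (\<Sum>k\<in>(\<Union>i\<in>I. K i). (norm (fcoeff 0 (H i) k))\<^sup>2) + \<epsilon>"
      if "i \<in> I" for i
    proof -
      have "(\<Sum>k\<in>K i. (norm (fcoeff 0 (H i) k))\<^sup>2) \<le> (\<Sum>k\<in>(\<Union>i\<in>I. K i). (norm (fcoeff 0 (H i) k))\<^sup>2)"
        by (rule sum_mono2[OF fin]) (use that in auto)
      then show ?thesis using K(2)[OF that] by linarith
    qed
  qed
qed

section \<open>Folding the line onto a unit interval\<close>

definition periodize :: "int set \<Rightarrow> (real \<Rightarrow> 'b::comm_monoid_add) \<Rightarrow> real \<Rightarrow> 'b" where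
  "periodize W H x = (\<Sum>n\<in>W. H (x + of_int n))"

lemma
  fixes H :: "real \<Rightarrow> 'b::{banach, second_countable_topology}"
  assumes H: "integrable lborel H" and W: "finite W" "\<And>x. H x \<noteq> 0 \<Longrightarrow> \<lfloor>x - s\<rfloor> \<in> W"
  shows integrable_periodize: "integrable (unit_interval s) (periodize W H)"
    and integral_periodize: "(\<integral>x. periodize W H x \<partial>unit_interval s) = (\<integral>x. H x \<partial>lborel)"
proof -
  let ?J = "\<lambda>n::int. {s + of_int n..<s + of_int n + 1}"
  have shift: "integrable lborel (\<lambda>x. H (x + of_int n))" for n :: int
    using lborel_integrable_real_affine[OF H, of 1 "of_int n"] by (simp add: add.commute)
  have shift': "integrable lborel (\<lambda>x. indicator {s..<s+1} x *\<^sub>R H (x + of_int n))" for n :: int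
    by (rule integrable_mult_indicator[OF _ shift]) simp
  have piece: "(\<integral>x. indicator (?J n) x *\<^sub>R H x \<partial>lborel) =
      (\<integral>x. indicator {s..<s+1} x *\<^sub>R H (x + of_int n) \<partial>lborel)" for n
  proof -
    have "(\<integral>x. indicator (?J n) x *\<^sub>R H x \<partial>lborel) =
      (\<integral>x. indicator (?J n) (of_int n + 1 * x) *\<^sub>R H (of_int n + 1 * x) \<partial>lborel)"
      by (subst lborel_integral_real_affine[where c = 1 and t = "of_int n"]) auto
    also have "\<dots> = (\<integral>x. indicator {s..<s+1} x *\<^sub>R H (x + of_int n) \<partial>lborel)"
      by (rule Bochner_Integration.integral_cong) (auto simp: indicator_def add.commute)
    finally show ?thesis .
  qed
  have split: "H x = (\<Sum>n\<in>W. indicator (?J n) x *\<^sub>R H x)" for x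
  proof (cases "H x = 0")
    case False
    have "indicator (?J n) x = (if n = \<lfloor>x - s\<rfloor> then 1 else 0 :: real)" for n
    proof -
      have "x \<in> ?J n \<longleftrightarrow> \<lfloor>x - s\<rfloor> = n"
        unfolding floor_eq_iff by auto
      then show ?thesis by (auto simp: indicator_def)
    qed
    then have "(\<Sum>n\<in>W. indicator (?J n) x *\<^sub>R H x) = (\<Sum>n\<in>W. if n = \<lfloor>x - s\<rfloor> then H x else 0)"
      by (intro sum.cong) auto
    then show ?thesis
      using W(1) W(2)[OF False] by simp
  qed simp
  show "integrable (unit_interval s) (periodize W H)"
    unfolding periodize_def
    by (intro Bochner_Integration.integrable_sum)
      (use shift' in \<open>simp add: unit_interval_def integrable_restrict_space\<close>)
  have "(\<integral>x. H x \<partial>lborel) = (\<integral>x. (\<Sum>n\<in>W. indicator (?J n) x *\<^sub>R H x) \<partial>lborel)"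
    by (rule Bochner_Integration.integral_cong) (use split in auto)
  also have "\<dots> = (\<Sum>n\<in>W. \<integral>x. indicator (?J n) x *\<^sub>R H x \<partial>lborel)"
    by (rule Bochner_Integration.integral_sum) (rule integrable_mult_indicator[OF _ H], simp)
  also have "\<dots> = (\<Sum>n\<in>W. \<integral>x. H (x + of_int n) \<partial>unit_interval s)"
    by (rule sum.cong) (simp_all add: piece unit_interval_def integral_restrict_space)
  also have "\<dots> = (\<integral>x. periodize W H x \<partial>unit_interval s)"
    unfolding periodize_def using shift'
    by (subst Bochner_Integration.integral_sum)
      (simp_all add: unit_interval_def integrable_restrict_space)
  finally show "(\<integral>x. periodize W H x \<partial>unit_interval s) = (\<integral>x. H x \<partial>lborel)" ..
qed

text \<open>Characters are 1-periodic, so a Fourier integral over the line only sees the periodization.\<close>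

lemma fcoeff_periodize:
  assumes H: "integrable lborel H" and W: "finite W" "\<And>x. H x \<noteq> 0 \<Longrightarrow> \<lfloor>x - s\<rfloor> \<in> W"
  shows "fcoeff s (periodize W H) k = (\<integral>x. H x * fchar (- k) x \<partial>lborel)"
proof -
  have "integrable lborel (\<lambda>x. H x * fchar (- k) x)"
    by (rule Bochner_Integration.integrable_bound[OF H]) (use H in \<open>auto simp: norm_mult\<close>)
  from integral_periodize[OF this W(1), of s] W(2)
  have "(\<integral>x. H x * fchar (- k) x \<partial>lborel) = (\<integral>x. periodize W (\<lambda>x. H x * fchar (- k) x) x \<partial>unit_interval s)"
    by simp
  then show ?thesis
    by (simp add: fcoeff_def periodize_def sum_distrib_right)
qed

lemma norm_sum_squared_le:
  fixes a :: "'i \<Rightarrow> 'b::real_normed_vector"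
  assumes "finite W"
  shows "(norm (\<Sum>n\<in>W. a n))\<^sup>2 \<le> of_nat (card W) * (\<Sum>n\<in>W. (norm (a n))\<^sup>2)"
proof -
  have "(norm (\<Sum>n\<in>W. a n))\<^sup>2 \<le> (\<Sum>n\<in>W. norm (a n))\<^sup>2"
    by (intro power_mono norm_sum) simp
  also have "\<dots> \<le> (\<Sum>n\<in>W. 1\<^sup>2) * (\<Sum>n\<in>W. (norm (a n))\<^sup>2)"
    using Cauchy_Schwarz_ineq_sum[of "\<lambda>_. 1" "\<lambda>n. norm (a n)" W] by simp
  finally show ?thesis by simp
qed

lemma
  fixes H :: "real \<Rightarrow> complex"
  assumes H: "integrable lborel H" "integrable lborel (\<lambda>x. (norm (H x))\<^sup>2)"
    and W: "finite W" "\<And>x. H x \<noteq> 0 \<Longrightarrow> \<lfloor>x - s\<rfloor> \<in> W"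
  shows square_integrable_periodize: "integrable (unit_interval s) (\<lambda>x. (norm (periodize W H x))\<^sup>2)"
    and integral_square_periodize_le: "(\<integral>x. (norm (periodize W H x))\<^sup>2 \<partial>unit_interval s)
      \<le> of_nat (card W) * (\<integral>x. (norm (H x))\<^sup>2 \<partial>lborel)"
proof -
  let ?P = "periodize W (\<lambda>x. (norm (H x))\<^sup>2)"
  have bound: "(norm (periodize W H x))\<^sup>2 \<le> of_nat (card W) * ?P x" for x
    unfolding periodize_def by (rule norm_sum_squared_le[OF W(1)])
  have int: "integrable (unit_interval s) (\<lambda>x. of_nat (card W) * ?P x)"
    by (intro integrable_mult_right integrable_periodize H W) (use W in auto)
  show *: "integrable (unit_interval s) (\<lambda>x. (norm (periodize W H x))\<^sup>2)"
    by (rule Bochner_Integration.integrable_bound[OF int])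
      (use integrable_periodize[OF H(1) W] bound in \<open>auto intro: order_trans[OF _ abs_ge_self]\<close>)
  have "(\<integral>x. (norm (periodize W H x))\<^sup>2 \<partial>unit_interval s) \<le> (\<integral>x. of_nat (card W) * ?P x \<partial>unit_interval s)"
    by (rule integral_mono[OF * int bound])
  also have "\<dots> = of_nat (card W) * (\<integral>x. (norm (H x))\<^sup>2 \<partial>lborel)"
    using integral_periodize[OF H(2) W(1), of s] W(2) by simp
  finally show "(\<integral>x. (norm (periodize W H x))\<^sup>2 \<partial>unit_interval s)
      \<le> of_nat (card W) * (\<integral>x. (norm (H x))\<^sup>2 \<partial>lborel)" .
qed

lemma bessel_periodize:
  assumes "integrable lborel H" "integrable lborel (\<lambda>x. (norm (H x))\<^sup>2)"
    and "finite W" "\<And>x. H x \<noteq> 0 \<Longrightarrow> \<lfloor>x - s\<rfloor> \<in> W" and "finite K"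
  shows "(\<Sum>k\<in>K. (norm (\<integral>x. H x * fchar (- k) x \<partial>lborel))\<^sup>2)
    \<le> (\<integral>x. (norm (periodize W H x))\<^sup>2 \<partial>unit_interval s)"
  using bessel_inequality[of "periodize W H" s K]
    square_integrable_periodize[of H W s] integrable_periodize[of H W s] fcoeff_periodize[of H W s] assms
  by (simp add: borel_measurable_integrable)

section \<open>Square-integrable functions\<close>

lemma L2_norm_squared: "(L2_norm f)\<^sup>2 = (\<integral>x. (norm (f x))\<^sup>2 \<partial>lborel)"
  by (simp add: L2_norm_def)

lemma integrable_indicator_Icc: "integrable lborel (indicator {a..b::real} :: real \<Rightarrow> real)"
  by (rule integrable_real_indicator) (auto simp: emeasure_lborel_Icc_eq)

lemma L2_bounded_support:
  assumes "f \<in> borel_measurable borel" "\<And>x. norm (f x) \<le> C" "\<And>x. x \<notin> {a..b} \<Longrightarrow> f x = 0"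
  shows "f \<in> L2" "integrable lborel f"
proof -
  have 1: "integrable lborel (\<lambda>x. C * indicator {a..b} x)" "integrable lborel (\<lambda>x. C\<^sup>2 * indicator {a..b} x)"
    using integrable_indicator_Icc by auto
  have C: "C \<ge> 0" using assms(2)[of 0] norm_ge_zero order_trans by blast
  show "integrable lborel f"
    by (rule Bochner_Integration.integrable_bound[OF 1(1)]) (use assms C in \<open>auto simp: indicator_def\<close>)
  have "integrable lborel (\<lambda>x. (norm (f x))\<^sup>2)"
  proof (rule Bochner_Integration.integrable_bound[OF 1(2)])
    have "(norm (f x))\<^sup>2 \<le> C\<^sup>2 * indicator {a..b} x" for x
      using power_mono[OF assms(2)[of x], of 2] assms(3)[of x] by (auto simp: indicator_def)
    then show "AE x in lborel. norm ((norm (f x))\<^sup>2) \<le> norm (C\<^sup>2 * indicator {a..b} x :: real)"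
      by (auto simp: order_trans[OF _ abs_ge_self])
  qed (use assms(1) in auto)
  then show "f \<in> L2" using assms(1) by (simp add: L2_def)
qed

lemma L2_mult_bounded:
  assumes f: "f \<in> L2" and u: "u \<in> borel_measurable borel" "\<And>x. norm (u x) \<le> C"
  shows "(\<lambda>x. f x * u x) \<in> L2"
proof -
  have [measurable]: "f \<in> borel_measurable borel" "u \<in> borel_measurable borel"
    using f u by (auto simp: L2_def)
  have int: "integrable lborel (\<lambda>x. C\<^sup>2 * (norm (f x))\<^sup>2)"
    using f by (auto simp: L2_def)
  have "integrable lborel (\<lambda>x. (norm (f x * u x))\<^sup>2)"
  proof (rule Bochner_Integration.integrable_bound[OF int])
    have "(norm (f x * u x))\<^sup>2 \<le> C\<^sup>2 * (norm (f x))\<^sup>2" for x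
      using power_mono[OF u(2)[of x], of 2] by (simp add: norm_mult power_mult_distrib mult.commute[of "C\<^sup>2"] mult_left_mono)
    then show "AE x in lborel. norm ((norm (f x * u x))\<^sup>2) \<le> norm (C\<^sup>2 * (norm (f x))\<^sup>2)"
      by (auto simp: order_trans[OF _ abs_ge_self])
  qed measurable
  then show ?thesis by (simp add: L2_def)
qed

lemma L2_add_le:
  assumes "f \<in> L2" "h \<in> L2"
  shows "(\<lambda>x. f x + h x) \<in> L2" "(L2_norm (\<lambda>x. f x + h x))\<^sup>2 \<le> 2 * (L2_norm f)\<^sup>2 + 2 * (L2_norm h)\<^sup>2"
proof -
  have [measurable]: "f \<in> borel_measurable borel" "h \<in> borel_measurable borel"
    and sq: "integrable lborel (\<lambda>x. (norm (f x))\<^sup>2)" "integrable lborel (\<lambda>x. (norm (h x))\<^sup>2)"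
    using assms by (auto simp: L2_def)
  have int: "integrable lborel (\<lambda>x. 2 * (norm (f x))\<^sup>2 + 2 * (norm (h x))\<^sup>2)"
    using sq by auto
  have bound: "(norm (f x + h x))\<^sup>2 \<le> 2 * (norm (f x))\<^sup>2 + 2 * (norm (h x))\<^sup>2" for x
    using power_mono[OF norm_triangle_ineq[of "f x" "h x"], of 2] sum_squares_bound[of "norm (f x)" "norm (h x)"]
    by (simp add: power2_sum)
  have *: "integrable lborel (\<lambda>x. (norm (f x + h x))\<^sup>2)"
    by (rule Bochner_Integration.integrable_bound[OF int])
      (use bound in \<open>auto intro: order_trans[OF _ abs_ge_self]\<close>)
  then show "(\<lambda>x. f x + h x) \<in> L2" by (simp add: L2_def)
  have "(\<integral>x. (norm (f x + h x))\<^sup>2 \<partial>lborel) \<le> (\<integral>x. 2 * (norm (f x))\<^sup>2 + 2 * (norm (h x))\<^sup>2 \<partial>lborel)"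
    by (rule integral_mono[OF * int bound])
  then show "(L2_norm (\<lambda>x. f x + h x))\<^sup>2 \<le> 2 * (L2_norm f)\<^sup>2 + 2 * (L2_norm h)\<^sup>2"
    using sq by (simp add: L2_norm_squared)
qed

lemma L2_integrable_of_bounded_support:
  assumes f: "f \<in> L2" and supp: "\<And>x. x \<notin> {a..b} \<Longrightarrow> f x = 0"
  shows "integrable lborel f"
proof -
  have int: "integrable lborel (\<lambda>x. indicator {a..b} x + (norm (f x))\<^sup>2 :: real)"
    using f integrable_indicator_Icc[of a b] by (auto simp: L2_def)
  have "norm (f x) \<le> indicator {a..b} x + (norm (f x))\<^sup>2" for x
  proof (cases "x \<in> {a..b}")
    case True
    have "norm (f x) \<le> 1 + (norm (f x))\<^sup>2"
      using zero_le_power2[of "norm (f x) - 1/2"] by (simp add: power2_eq_square algebra_simps)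
    then show ?thesis using True by simp
  qed (simp add: supp)
  then show ?thesis
    by (intro Bochner_Integration.integrable_bound[OF int])
      (use f in \<open>auto simp: L2_def intro: order_trans[OF _ abs_ge_self]\<close>)
qed

lemma L2_diff:
  assumes "f \<in> L2" "h \<in> L2"
  shows "(\<lambda>x. f x - h x) \<in> L2"
proof -
  have "(\<lambda>x. - h x) \<in> L2" using assms(2) by (simp add: L2_def)
  from L2_add_le(1)[OF assms(1) this] show ?thesis by simp
qed

lemma L2_bounded_support_dense:
  assumes f: "f \<in> L2" and "\<epsilon> > 0"
  obtains u C where "u \<in> borel_measurable borel" "C > 0" "\<And>x. norm (u x) \<le> C" "\<And>x. \<bar>x\<bar> > C \<Longrightarrow> u x = 0"
    "(L2_norm (\<lambda>x. f x - u x))\<^sup>2 < \<epsilon>"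
proof -
  have [measurable]: "f \<in> borel_measurable borel" and sq: "integrable lborel (\<lambda>x. (norm (f x))\<^sup>2)"
    using f by (auto simp: L2_def)
  define u where "u n x = (if \<bar>x\<bar> \<le> real n \<and> norm (f x) \<le> real n then f x else 0)" for n :: nat and x
  have [measurable]: "u n \<in> borel_measurable borel" for n
    unfolding u_def by measurable
  have "(\<lambda>n. \<integral>x. (norm (f x - u n x))\<^sup>2 \<partial>lborel) \<longlonglongrightarrow> (\<integral>x. 0 \<partial>(lborel :: real measure))"
  proof (rule integral_dominated_convergence[OF _ _ sq])
    show "AE x in lborel. (\<lambda>n. (norm (f x - u n x))\<^sup>2) \<longlonglongrightarrow> 0"
    proof (rule AE_I2)
      fix x :: real
      have "\<forall>\<^sub>F n in sequentially. (norm (f x - u n x))\<^sup>2 = 0"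
        using eventually_ge_at_top[of "nat \<lceil>max \<bar>x\<bar> (norm (f x))\<rceil>"]
        by eventually_elim (simp add: u_def nat_le_iff ceiling_le_iff)
      then show "(\<lambda>n. (norm (f x - u n x))\<^sup>2) \<longlonglongrightarrow> 0"
        by (rule tendsto_eventually)
    qed
  qed (auto simp: u_def)
  then have lim: "(\<lambda>n. (L2_norm (\<lambda>x. f x - u n x))\<^sup>2) \<longlonglongrightarrow> 0"
    by (simp add: L2_norm_squared)
  from eventually_conj[OF eventually_ge_at_top[of 1] order_tendstoD(2)[OF lim \<open>\<epsilon> > 0\<close>]]
  obtain n where n: "n \<ge> 1" "(L2_norm (\<lambda>x. f x - u n x))\<^sup>2 < \<epsilon>"
    using eventually_happens'[OF sequentially_bot] by blast
  show thesis
    by (rule that[of "u n" "real n"]) (use n in \<open>auto simp: u_def\<close>)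
qed

text \<open>
  A bounded function of bounded support is an almost-everywhere limit of continuous functions.
  Clipping the values and cutting off the support of these makes the convergence dominated.
\<close>

lemma continuous_bounded_support_dense:
  fixes u :: "real \<Rightarrow> complex"
  assumes u: "u \<in> borel_measurable borel" "C > 0" "\<And>x. norm (u x) \<le> C" "\<And>x. \<bar>x\<bar> > C \<Longrightarrow> u x = 0"
    and "\<epsilon> > 0"
  obtains h where "continuous_on UNIV h" "\<And>x. \<bar>x\<bar> \<ge> C + 1 \<Longrightarrow> h x = 0" "\<And>x. norm (h x) \<le> C"
    "(L2_norm (\<lambda>x. u x - h x))\<^sup>2 < \<epsilon>"
proof -
  have "u \<in> borel_measurable lebesgue"
    using u(1) by (simp add: measurable_completion)
  then have "u measurable_on UNIV"
    by (rule lebesgue_measurable_imp_measurable_on) simp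
  then obtain N v where N: "negligible N" and v: "\<And>n. continuous_on UNIV (v n)"
    "\<And>x. x \<notin> N \<Longrightarrow> (\<lambda>n. v n x) \<longlonglongrightarrow> u x"
    unfolding measurable_on_def by auto
  \<comment> \<open>\<open>clip\<close> is the identity on the disc of radius \<open>C\<close> and retracts its complement onto the boundary.\<close>
  define clip where "clip z = of_real (C / max C (norm z)) * z" for z :: complex
  define cut where "cut x = max 0 (min 1 (C + 1 - \<bar>x\<bar>))" for x :: real
  define h where "h n x = of_real (cut x) * clip (v n x)" for n x
  have mx: "max C (norm z) > 0" for z :: complex using u(2) by (simp add: less_max_iff_disj)
  have clip_cont: "continuous_on UNIV clip"
    unfolding clip_def using mx by (intro continuous_intros) (auto simp: less_le)
  have clip_le: "norm (clip z) \<le> C" for z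
  proof -
    have "norm (clip z) = C * norm z / max C (norm z)"
      using u(2) mx[of z] by (simp add: clip_def norm_mult norm_divide)
    also have "\<dots> \<le> C"
      using u(2) mx[of z] by (simp add: pos_divide_le_eq)
    finally show ?thesis .
  qed
  have clip_id: "clip z = z" if "norm z \<le> C" for z
    using u(2) that by (simp add: clip_def max_def)
  have cut01: "0 \<le> cut x" "cut x \<le> 1" for x by (auto simp: cut_def)
  have h_cont: "continuous_on UNIV (h n)" for n
    unfolding h_def cut_def
    by (intro continuous_intros continuous_on_compose2[OF clip_cont v(1)]) auto
  have h_zero: "h n x = 0" if "\<bar>x\<bar> \<ge> C + 1" for n x
    using that by (simp add: h_def cut_def)
  have h_le: "norm (h n x) \<le> C" for n x
  proof -
    have "norm (h n x) = cut x * norm (clip (v n x))"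
      using cut01(1)[of x] by (simp add: h_def norm_mult)
    also have "\<dots> \<le> norm (clip (v n x))"
      by (rule mult_left_le_one_le) (use cut01 in auto)
    finally show ?thesis using clip_le[of "v n x"] by linarith
  qed
  have h_lim: "(\<lambda>n. h n x) \<longlonglongrightarrow> u x" if "x \<notin> N" for x
  proof -
    have "(\<lambda>n. clip (v n x)) \<longlonglongrightarrow> clip (u x)"
      by (rule continuous_on_tendsto_compose[OF clip_cont v(2)[OF that]]) auto
    then have "(\<lambda>n. h n x) \<longlonglongrightarrow> of_real (cut x) * u x"
      unfolding h_def clip_id[OF u(3)] by (intro tendsto_intros)
    moreover have "of_real (cut x) * u x = u x"
      using u(4)[of x] by (cases "\<bar>x\<bar> > C") (auto simp: cut_def)
    ultimately show ?thesis by simp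
  qed
  have [measurable]: "h n \<in> borel_measurable borel" for n
    by (rule borel_measurable_continuous_onI[OF h_cont])
  note [measurable] = u(1)
  let ?D = "\<lambda>x. (2 * C)\<^sup>2 * indicator {-(C+1)..C+1} x :: real"
  have "(\<lambda>n. \<integral>x. (norm (u x - h n x))\<^sup>2 \<partial>lborel) \<longlonglongrightarrow> (\<integral>x. 0 \<partial>(lborel :: real measure))"
  proof (rule integral_dominated_convergence[where w = ?D])
    show "integrable lborel ?D"
      using integrable_indicator_Icc by auto
    have "AE x in lborel. x \<notin> N"
      using N AE_not_in[of N lebesgue] by (simp add: negligible_iff_null_sets AE_completion_iff)
    then show "AE x in lborel. (\<lambda>n. (norm (u x - h n x))\<^sup>2) \<longlonglongrightarrow> 0"
    proof eventually_elim
      case (elim x)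
      have "(\<lambda>n. (norm (u x - h n x))\<^sup>2) \<longlonglongrightarrow> (norm (u x - u x))\<^sup>2"
        by (intro tendsto_intros h_lim elim)
      then show ?case by simp
    qed
    fix n
    have "(norm (u x - h n x))\<^sup>2 \<le> ?D x" for x
    proof (cases "x \<in> {-(C+1)..C+1}")
      case True
      have "norm (u x - h n x) \<le> 2 * C"
        using norm_triangle_ineq4[of "u x" "h n x"] u(3)[of x] h_le[of n x] by linarith
      from power_mono[OF this, of 2] True show ?thesis by simp
    next
      case False
      then have "\<bar>x\<bar> \<ge> C + 1" by auto
      then show ?thesis using h_zero u(4)[of x] by simp
    qed
    then show "AE x in lborel. norm ((norm (u x - h n x))\<^sup>2) \<le> ?D x" by simp
  qed auto
  then have lim: "(\<lambda>n. (L2_norm (\<lambda>x. u x - h n x))\<^sup>2) \<longlonglongrightarrow> 0"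
    by (simp add: L2_norm_squared)
  from order_tendstoD(2)[OF lim \<open>\<epsilon> > 0\<close>]
  obtain n where "(L2_norm (\<lambda>x. u x - h n x))\<^sup>2 < \<epsilon>"
    using eventually_happens'[OF sequentially_bot] by blast
  then show thesis
    using that[of "h n"] h_cont h_zero h_le by blast
qed

lemma L2_continuous_dense:
  assumes f: "f \<in> L2" and "\<epsilon> > 0"
  obtains h T where "continuous_on UNIV h" "\<And>x. \<bar>x\<bar> \<ge> of_int T \<Longrightarrow> h x = 0" "T > 0" "h \<in> L2"
    "(L2_norm (\<lambda>x. f x - h x))\<^sup>2 < \<epsilon>"
proof -
  have e: "\<epsilon> / 4 > 0" using assms by simp
  obtain u C where u: "u \<in> borel_measurable borel" "C > 0" "\<And>x. norm (u x) \<le> C" "\<And>x. \<bar>x\<bar> > C \<Longrightarrow> u x = 0"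
    "(L2_norm (\<lambda>x. f x - u x))\<^sup>2 < \<epsilon> / 4"
    using L2_bounded_support_dense[OF f e] by blast
  obtain h where h: "continuous_on UNIV h" "\<And>x. \<bar>x\<bar> \<ge> C + 1 \<Longrightarrow> h x = 0" "\<And>x. norm (h x) \<le> C"
    "(L2_norm (\<lambda>x. u x - h x))\<^sup>2 < \<epsilon> / 4"
    using continuous_bounded_support_dense[OF u(1-4) e] by blast
  have uL: "u \<in> L2"
    by (rule L2_bounded_support(1)[OF u(1,3), of "-C" C]) (use u(4) in auto)
  have hL: "h \<in> L2"
    by (rule L2_bounded_support(1)[OF borel_measurable_continuous_onI[OF h(1)] h(3), of "-(C+1)" "C+1"]) (use h(2) in auto)
  have "(L2_norm (\<lambda>x. (f x - u x) + (u x - h x)))\<^sup>2 \<le>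
     2 * (L2_norm (\<lambda>x. f x - u x))\<^sup>2 + 2 * (L2_norm (\<lambda>x. u x - h x))\<^sup>2"
    by (intro L2_add_le L2_diff f uL hL)
  then have "(L2_norm (\<lambda>x. f x - h x))\<^sup>2 < \<epsilon>"
    using u(5) h(4) by simp
  moreover have "h x = 0" if "\<bar>x\<bar> \<ge> of_int \<lceil>C + 1\<rceil>" for x
    using that by (intro h(2)) linarith
  ultimately show thesis
    using that[of h "\<lceil>C + 1\<rceil>"] h(1) hL u(2) by auto
qed

section \<open>Gabor systems of integer oversampling with a compactly supported window\<close>

text \<open>
  The modulation step is normalised to \<open>1\<close> and the translation step is \<open>1 / q\<close>; a dilation reduces
  the general case of integer oversampling to this one.
\<close>

locale gabor_window =
  fixes g :: "real \<Rightarrow> real" and L q :: int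
  assumes continuous: "continuous_on UNIV g"
    and support: "\<And>x. \<bar>x\<bar> \<ge> of_int L \<Longrightarrow> g x = 0"
    and L_pos: "L > 0" and q_pos: "q > 0"
begin

abbreviation \<phi> :: "int \<times> int \<Rightarrow> real \<Rightarrow> complex" where
  "\<phi> \<equiv> gabor_system (\<lambda>x. complex_of_real (g x)) (1 / of_int q) 1"

text \<open>
  The function whose Fourier integrals are the frame coefficients with translation index \<open>m\<close>.
\<close>

definition localized :: "(real \<Rightarrow> complex) \<Rightarrow> int \<Rightarrow> real \<Rightarrow> complex" where
  "localized f m x = f x * of_real (g (x - of_int m / of_int q))"

lemma borel_measurable_window [measurable]: "g \<in> borel_measurable borel"
  by (intro borel_measurable_continuous_onI continuous)

lemma window_bounded: obtains G where "G > 0" "\<And>x. \<bar>g x\<bar> \<le> G"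
proof -
  have "bounded (g ` {- of_int L..of_int L})"
    by (intro compact_imp_bounded compact_continuous_image continuous_on_subset[OF continuous]) auto
  then obtain G where G: "\<forall>y\<in>g ` {- of_int L..of_int L}. norm y \<le> G"
    unfolding bounded_iff by blast
  have "\<bar>g x\<bar> \<le> max G 1" for x
  proof (cases "\<bar>x\<bar> \<ge> of_int L")
    case False
    then have "x \<in> {- of_int L..of_int L}" by auto
    then have "norm (g x) \<le> G" using G by blast
    then show ?thesis by simp
  qed (simp add: support)
  then show thesis by (intro that[of "max G 1"]) auto
qed

lemma window_translate_nonzero:
  assumes "g (x - of_int m / of_int q) \<noteq> 0"
  shows "\<bar>x - of_int m / of_int q\<bar> < of_int L"
  using assms support not_le by blast

lemma localized_L2:
  assumes "f \<in> L2"
  shows "localized f m \<in> L2" "integrable lborel (localized f m)"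
    "integrable lborel (\<lambda>x. (norm (localized f m x))\<^sup>2)"
proof -
  obtain G where G: "\<And>x. \<bar>g x\<bar> \<le> G" using window_bounded by blast
  show 1: "localized f m \<in> L2"
    unfolding localized_def by (rule L2_mult_bounded[OF assms, where C = G]) (use G in auto)
  then show "integrable lborel (\<lambda>x. (norm (localized f m x))\<^sup>2)"
    by (simp add: L2_def)
  show "integrable lborel (localized f m)"
    by (rule L2_integrable_of_bounded_support[OF 1,
          where a = "of_int m / of_int q - of_int L" and b = "of_int m / of_int q + of_int L"])
      (auto simp: localized_def intro!: support)
qed

lemma gabor_system_L2: "\<phi> i \<in> L2"
proof -
  obtain k m where i: "i = (k, m)" by (cases i)
  obtain G where G: "\<And>x. \<bar>g x\<bar> \<le> G" using window_bounded by blast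
  have eq: "\<phi> i = (\<lambda>x. fchar k x * of_real (g (x - of_int m / of_int q)))"
    by (simp add: i gabor_system_def fchar_def cis_conv_exp fun_eq_iff mult_ac)
  show ?thesis
    unfolding eq
    by (rule L2_bounded_support(1)[where C = G and a = "of_int m / of_int q - of_int L"
          and b = "of_int m / of_int q + of_int L"])
      (use G in \<open>auto simp: norm_mult intro!: support\<close>)
qed

lemma inner_gabor_system:
  "L2_inner f (\<phi> (k, m)) = (\<integral>x. localized f m x * fchar (- k) x \<partial>lborel)"
  unfolding L2_inner_def fchar_minus
  by (rule Bochner_Integration.integral_cong)
    (simp_all add: gabor_system_def localized_def fchar_def cis_conv_exp mult_ac)

lemma bessel_gabor_system:
  assumes "f \<in> L2" "finite W" "\<And>x. localized f m x \<noteq> 0 \<Longrightarrow> \<lfloor>x - s\<rfloor> \<in> W" "finite K"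
  shows "(\<Sum>k\<in>K. (norm (L2_inner f (\<phi> (k, m))))\<^sup>2)
    \<le> (\<integral>x. (norm (periodize W (localized f m) x))\<^sup>2 \<partial>unit_interval s)"
  unfolding inner_gabor_system
  by (rule bessel_periodize) (use localized_L2 assms in auto)

lemma finite_translates:
  "{m. \<bar>x - real_of_int m / of_int q\<bar> < of_int L} \<subseteq> {\<lfloor>of_int q * x\<rfloor> - q * L..\<lfloor>of_int q * x\<rfloor> + q * L + 1}"
proof
  fix m assume "m \<in> {m. \<bar>x - real_of_int m / of_int q\<bar> < of_int L}"
  then have "\<bar>real_of_int q * x - of_int m\<bar> < of_int (q * L)"
    using q_pos by (simp add: abs_less_iff field_simps)
  moreover have "\<lfloor>y\<rfloor> - p \<le> m \<and> m \<le> \<lfloor>y\<rfloor> + p + 1" if "\<bar>y - of_int m\<bar> < of_int p" for y :: real and p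
    using that by linarith
  ultimately show "m \<in> {\<lfloor>of_int q * x\<rfloor> - q * L..\<lfloor>of_int q * x\<rfloor> + q * L + 1}"
    by (auto simp del: of_int_mult)
qed

lemma translates_overlap:
  assumes "finite M" "\<And>x. \<bar>g x\<bar> \<le> G"
  shows "(\<Sum>m\<in>M. (g (x - of_int m / of_int q))\<^sup>2) \<le> of_int (2 * q * L + 2) * G\<^sup>2"
proof -
  let ?J = "{\<lfloor>of_int q * x\<rfloor> - q * L..\<lfloor>of_int q * x\<rfloor> + q * L + 1}"
  have "(\<Sum>m\<in>M. (g (x - of_int m / of_int q))\<^sup>2) = (\<Sum>m\<in>M \<inter> ?J. (g (x - of_int m / of_int q))\<^sup>2)"
    by (rule sum.mono_neutral_right)
      (use assms finite_translates[of x] window_translate_nonzero[of x] in auto)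
  also have "\<dots> \<le> (\<Sum>m\<in>?J. (g (x - of_int m / of_int q))\<^sup>2)"
    by (rule sum_mono2) auto
  also have "\<dots> \<le> (\<Sum>m\<in>?J. G\<^sup>2)"
    by (intro sum_mono abs_le_square_iff[THEN iffD1]) (use assms(2) in \<open>auto intro: order_trans[OF _ abs_ge_self]\<close>)
  also have "\<dots> = of_int (2 * q * L + 2) * G\<^sup>2"
    using q_pos L_pos by (simp add: algebra_simps)
  finally show ?thesis .
qed

text \<open>
  The upper frame bound: Bessel's inequality for each translate of the window, whose support
  folds onto one period boundedly often, and the bounded overlap of the translates.
\<close>

lemma gabor_upper_bound:
  obtains B where "B > 0"
    "\<And>f. f \<in> L2 \<Longrightarrow> (\<lambda>i. (norm (L2_inner f (\<phi> i)))\<^sup>2) summable_on UNIV"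
    "\<And>f. f \<in> L2 \<Longrightarrow> (\<Sum>\<^sub>\<infinity>i. (norm (L2_inner f (\<phi> i)))\<^sup>2) \<le> B * (L2_norm f)\<^sup>2"
proof -
  obtain G where G: "G > 0" "\<And>x. \<bar>g x\<bar> \<le> G" using window_bounded by blast
  define B where "B = of_int (2 * L + 3) * (of_int (2 * q * L + 2) * G\<^sup>2)"
  have fin: "(\<Sum>i\<in>F. (norm (L2_inner f (\<phi> i)))\<^sup>2) \<le> B * (L2_norm f)\<^sup>2" if f: "f \<in> L2" and F: "finite F" for f F
  proof -
    define K M where "K = fst ` F" and "M = snd ` F"
    have KM: "finite K" "finite M" "F \<subseteq> K \<times> M" using F by (force simp: K_def M_def)+
    have sq: "integrable lborel (\<lambda>x. (norm (f x))\<^sup>2)" using f by (simp add: L2_def)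
    have "(\<Sum>i\<in>F. (norm (L2_inner f (\<phi> i)))\<^sup>2) \<le> (\<Sum>i\<in>K \<times> M. (norm (L2_inner f (\<phi> i)))\<^sup>2)"
      by (rule sum_mono2) (use KM in auto)
    also have "\<dots> = (\<Sum>m\<in>M. \<Sum>k\<in>K. (norm (L2_inner f (\<phi> (k, m))))\<^sup>2)"
      by (subst sum.swap) (simp add: sum.cartesian_product)
    also have "\<dots> \<le> (\<Sum>m\<in>M. of_int (2 * L + 3) * (\<integral>x. (norm (localized f m x))\<^sup>2 \<partial>lborel))"
    proof (rule sum_mono)
      fix m
      let ?W = "{\<lfloor>real_of_int m / of_int q\<rfloor> - L - 1..\<lfloor>real_of_int m / of_int q\<rfloor> + L + 1}"
      have W: "\<lfloor>x - 0\<rfloor> \<in> ?W" if "localized f m x \<noteq> 0" for x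
      proof -
        have "\<bar>x - of_int m / of_int q\<bar> < of_int L"
          using that window_translate_nonzero by (auto simp: localized_def)
        then show ?thesis by (auto simp: abs_less_iff) linarith+
      qed
      have "(\<Sum>k\<in>K. (norm (L2_inner f (\<phi> (k, m))))\<^sup>2)
          \<le> (\<integral>x. (norm (periodize ?W (localized f m) x))\<^sup>2 \<partial>unit_interval 0)"
        by (rule bessel_gabor_system[OF f _ W KM(1)]) auto
      also have "\<dots> \<le> of_nat (card ?W) * (\<integral>x. (norm (localized f m x))\<^sup>2 \<partial>lborel)"
        by (rule integral_square_periodize_le[OF localized_L2(2,3)[OF f] _ W]) auto
      also have "real (card ?W) = of_int (2 * L + 3)" using L_pos by simp
      finally show "(\<Sum>k\<in>K. (norm (L2_inner f (\<phi> (k, m))))\<^sup>2)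
        \<le> of_int (2 * L + 3) * (\<integral>x. (norm (localized f m x))\<^sup>2 \<partial>lborel)" .
    qed
    also have "\<dots> = of_int (2 * L + 3) * (\<integral>x. (\<Sum>m\<in>M. (norm (localized f m x))\<^sup>2) \<partial>lborel)"
      by (simp add: sum_distrib_left Bochner_Integration.integral_sum localized_L2(3)[OF f])
    also have "\<dots> \<le> of_int (2 * L + 3) * (\<integral>x. of_int (2 * q * L + 2) * G\<^sup>2 * (norm (f x))\<^sup>2 \<partial>lborel)"
    proof (intro mult_left_mono integral_mono)
      fix x
      have "(\<Sum>m\<in>M. (norm (localized f m x))\<^sup>2) = (\<Sum>m\<in>M. (g (x - of_int m / of_int q))\<^sup>2) * (norm (f x))\<^sup>2"
        by (simp add: localized_def norm_mult power_mult_distrib sum_distrib_left mult.commute)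
      also have "\<dots> \<le> of_int (2 * q * L + 2) * G\<^sup>2 * (norm (f x))\<^sup>2"
        by (intro mult_right_mono translates_overlap KM G) simp
      finally show "(\<Sum>m\<in>M. (norm (localized f m x))\<^sup>2) \<le> of_int (2 * q * L + 2) * G\<^sup>2 * (norm (f x))\<^sup>2" .
    qed (use L_pos sq localized_L2(3)[OF f] in auto)
    also have "\<dots> = B * (L2_norm f)\<^sup>2"
      by (simp add: B_def L2_norm_squared)
    finally show ?thesis .
  qed
  have summable: "(\<lambda>i. (norm (L2_inner f (\<phi> i)))\<^sup>2) summable_on UNIV" if "f \<in> L2" for f
    by (rule nonneg_bdd_above_summable_on) (use fin[OF that] in \<open>auto intro!: bdd_aboveI\<close>)
  show thesis
  proof (rule that)
    show "B > 0"
      unfolding B_def using L_pos q_pos G(1) by (intro mult_pos_pos) (auto intro!: add_pos_pos mult_pos_pos)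
    show "(\<Sum>\<^sub>\<infinity>i. (norm (L2_inner f (\<phi> i)))\<^sup>2) \<le> B * (L2_norm f)\<^sup>2" if "f \<in> L2" for f
      by (rule infsum_le_finite_sums[OF summable[OF that] fin[OF that]])
  qed (rule summable)
qed

end

section \<open>The Zak transform and the frame criterion\<close>

context gabor_window
begin

text \<open>
  The Zak transform of the window. The second variable is the exponent of a character rather than a
  point of the unit circle, so that Fourier series and compactness can be used on intervals.
\<close>

definition zak :: "real \<Rightarrow> real \<Rightarrow> complex" where
  "zak y t = (\<Sum>k | g (y + of_int k) \<noteq> 0. of_real (g (y + of_int k)) * fchar k t)"

lemma zak_eq_sum:
  assumes "finite K" "\<And>k. g (y + of_int k) \<noteq> 0 \<Longrightarrow> k \<in> K"
  shows "zak y t = (\<Sum>k\<in>K. of_real (g (y + of_int k)) * fchar k t)"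
  unfolding zak_def by (rule sum.mono_neutral_left) (use assms in auto)

lemma zak_eq_sum_interval:
  assumes "\<bar>y\<bar> \<le> of_int M"
  shows "zak y t = (\<Sum>k\<in>{-(M + L)..M + L}. of_real (g (y + of_int k)) * fchar k t)"
proof (rule zak_eq_sum)
  fix k assume "g (y + of_int k) \<noteq> 0"
  then have "\<bar>y + of_int k\<bar> < of_int L" using support not_le by blast
  then show "k \<in> {-(M + L)..M + L}" using assms by auto
qed simp

lemma continuous_on_zak: "continuous_on ({- of_int M..of_int M} \<times> UNIV) (\<lambda>(y, t). zak y t)"
proof -
  have "continuous_on ({- of_int M..of_int M} \<times> UNIV)
     (\<lambda>p. \<Sum>k\<in>{-(M + L)..M + L}. of_real (g (fst p + of_int k)) * fchar k (snd p))"
    by (intro continuous_intros continuous_on_compose2[OF continuous]) auto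
  then show ?thesis
    by (rule continuous_on_eq) (use zak_eq_sum_interval[of _ M] in \<open>auto simp: abs_le_iff\<close>)
qed

lemma zak_add_int: "zak (y + of_int j) t = fchar (- j) t * zak y t"
proof -
  have "zak (y + of_int j) t = (\<Sum>k | g (y + of_int k) \<noteq> 0. of_real (g (y + of_int k)) * fchar (k - j) t)"
    unfolding zak_def
    by (rule sum.reindex_bij_witness[of _ "\<lambda>k. k - j" "\<lambda>k. k + j"]) (auto simp: algebra_simps)
  also have "\<dots> = fchar (- j) t * zak y t"
    using fchar_add[of _ "-j" t] by (simp add: zak_def sum_distrib_left mult_ac)
  finally show ?thesis .
qed

definition zak_nonvanishing :: bool where
  "zak_nonvanishing \<longleftrightarrow> (\<forall>y t. \<exists>m::int. zak (y + of_int m / of_int q) t \<noteq> 0)"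

text \<open>
  Quasi-periodicity leaves only \<open>q\<close> translates to look at, and compactness turns pointwise
  non-vanishing into a uniform lower bound.
\<close>

lemma zak_uniform_lower_bound:
  assumes zak_nonvanishing
  obtains A where "A > 0"
    "\<And>y t. 0 \<le> y \<Longrightarrow> y \<le> 1 \<Longrightarrow> -1 \<le> t \<Longrightarrow> t \<le> 0 \<Longrightarrow> A \<le> (\<Sum>r\<in>{0..<q}. (norm (zak (y + of_int r / of_int q) t))\<^sup>2)"
proof -
  define Q where "Q p = (\<Sum>r\<in>{0..<q}. (norm (zak (fst p + of_int r / of_int q) (snd p)))\<^sup>2)" for p
  have cont: "continuous_on ({0..1} \<times> {-1..0}) Q"
    unfolding Q_def
  proof (intro continuous_intros)
    fix r assume r: "r \<in> {0..<q}"
    then have "0 \<le> of_int r / real_of_int q" "of_int r / real_of_int q \<le> 1" using q_pos by simp_all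
    then have sub: "(\<lambda>p. (fst p + of_int r / real_of_int q, snd p)) ` ({0..1} \<times> {-1..0::real})
        \<subseteq> {- of_int 2..of_int 2} \<times> UNIV"
      by (force simp del: divide_le_eq_1)
    show "continuous_on ({0..1} \<times> {-1..0}) (\<lambda>p. zak (fst p + of_int r / of_int q) (snd p))"
      using continuous_on_compose2[OF continuous_on_zak[of 2] _ sub]
      by (simp add: continuous_intros)
  qed
  have "compact ({0..1::real} \<times> {-1..0::real})" by (intro compact_Times) auto
  from continuous_attains_inf[OF this _ cont] obtain p where
    p: "p \<in> {0..1} \<times> {-1..0}" "\<And>p'. p' \<in> {0..1} \<times> {-1..0} \<Longrightarrow> Q p \<le> Q p'"
    by auto
  obtain m :: int where m: "zak (fst p + of_int m / of_int q) (snd p) \<noteq> 0"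
    using assms unfolding zak_nonvanishing_def by blast
  have "fst p + of_int m / of_int q = (fst p + of_int (m mod q) / of_int q) + of_int (m div q)"
  proof -
    have "real_of_int m = of_int (m div q) * of_int q + of_int (m mod q)"
      by (metis div_mult_mod_eq of_int_add of_int_mult)
    then show ?thesis using q_pos by (simp add: field_simps)
  qed
  with m have "zak (fst p + of_int (m mod q) / of_int q) (snd p) \<noteq> 0"
    by (simp add: zak_add_int)
  moreover have "m mod q \<in> {0..<q}" using q_pos by simp
  ultimately have "Q p > 0"
    unfolding Q_def by (intro sum_pos2[of _ "m mod q"]) auto
  then show thesis
    using p(2) by (intro that[of "Q p"]) (auto simp: Q_def)
qed

text \<open>
  For fixed \<open>x\<close> the map from the samples \<open>c\<close> to the correlations with the translates of the window
  splits into \<open>q\<close> convolutions, which the Fourier series turns into multiplications by the values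
  of the Zak transform on a coset.
\<close>

lemma correlation_lower_bound:
  fixes c :: "int \<Rightarrow> complex" and T :: int
  assumes A: "\<And>y t. 0 \<le> y \<Longrightarrow> y \<le> 1 \<Longrightarrow> -1 \<le> t \<Longrightarrow> t \<le> 0 \<Longrightarrow> A \<le> (\<Sum>r\<in>{0..<q}. (norm (zak (y + of_int r / of_int q) t))\<^sup>2)"
    and x: "0 \<le> x" "x \<le> 1"
  defines "J \<equiv> {-(T + L + 2)..T + L + 2}"
  shows "A * (\<Sum>n\<in>{-T..T}. (norm (c n))\<^sup>2) \<le>
    (\<Sum>r\<in>{0..<q}. \<Sum>j\<in>J. (norm (\<Sum>n\<in>{-T..T}. c n * of_real (g (x + of_int r / of_int q + of_int (n - j)))))\<^sup>2)"
proof -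
  \<comment> \<open>\<open>J\<close> is large enough to contain every \<open>j\<close> with a non-zero correlation: the shift
    \<open>x + r / q\<close> lies in \<open>[0, 2)\<close>.\<close>
  define C where "C t = (\<Sum>n\<in>{-T..T}. c n * fchar n t)" for t
  define G where "G r j = (\<Sum>n\<in>{-T..T}. c n * of_real (g (x + of_int r / of_int q + of_int (n - j))))" for r j
  have conv: "(\<Sum>j\<in>J. G r j * fchar j t) = C t * zak (x + of_int r / of_int q) (- t)" if r: "r \<in> {0..<q}" for r t
  proof -
    let ?y = "x + of_int r / real_of_int q"
    have y: "0 \<le> ?y" "?y < 2"
      using r x q_pos by (auto simp: add_nonneg_nonneg intro: add_le_less_mono[of x 1 _ 1, simplified])
    have inner: "(\<Sum>j\<in>J. of_real (g (?y + of_int (n - j))) * fchar j t) = fchar n t * zak ?y (- t)"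
      if n: "n \<in> {-T..T}" for n
    proof -
      have "zak ?y (- t) = (\<Sum>k\<in>(\<lambda>j. n - j) ` J. of_real (g (?y + of_int k)) * fchar k (- t))"
      proof (rule zak_eq_sum)
        fix k assume "g (?y + of_int k) \<noteq> 0"
        then have "\<bar>?y + of_int k\<bar> < of_int L" using support not_le by blast
        with y have "- L - 2 \<le> k" "k \<le> L" by linarith+
        with n have "n - k \<in> J" by (auto simp: J_def)
        then show "k \<in> (\<lambda>j. n - j) ` J" by (rule rev_image_eqI) simp
      qed (simp add: J_def)
      also have "\<dots> = (\<Sum>j\<in>J. of_real (g (?y + of_int (n - j))) * fchar (n - j) (- t))"
        by (subst sum.reindex) (auto simp: inj_on_def)
      finally have "fchar n t * zak ?y (- t) = (\<Sum>j\<in>J. of_real (g (?y + of_int (n - j))) * (fchar n t * fchar (j - n) t))"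
        by (simp add: sum_distrib_left fchar_uminus mult_ac flip: fchar_minus)
      then show ?thesis by (simp flip: fchar_add)
    qed
    have "(\<Sum>j\<in>J. G r j * fchar j t) = (\<Sum>n\<in>{-T..T}. c n * (\<Sum>j\<in>J. of_real (g (?y + of_int (n - j))) * fchar j t))"
      unfolding G_def sum_distrib_left sum_distrib_right by (subst sum.swap) (simp add: mult_ac)
    also have "\<dots> = C t * zak ?y (- t)"
      unfolding C_def sum_distrib_right by (rule sum.cong) (simp_all only: inner mult.assoc)
    finally show ?thesis .
  qed
  have intC: "integrable (unit_interval 0) (\<lambda>t. (norm (\<Sum>k\<in>K. d k * fchar k t))\<^sup>2)" for K and d :: "int \<Rightarrow> complex"
  proof (rule integrable_unit_interval_bounded)
    fix t
    have "norm (\<Sum>k\<in>K. d k * fchar k t) \<le> (\<Sum>k\<in>K. norm (d k))"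
      by (rule order_trans[OF norm_sum]) (simp add: norm_mult)
    then show "norm ((norm (\<Sum>k\<in>K. d k * fchar k t))\<^sup>2) \<le> (\<Sum>k\<in>K. norm (d k))\<^sup>2"
      by (simp add: power_mono)
  qed measurable
  have "A * (\<Sum>n\<in>{-T..T}. (norm (c n))\<^sup>2) = (\<integral>t. A * (norm (C t))\<^sup>2 \<partial>unit_interval 0)"
    by (simp add: C_def trig_poly_norm)
  also have "\<dots> \<le> (\<integral>t. (\<Sum>r\<in>{0..<q}. (norm (\<Sum>j\<in>J. G r j * fchar j t))\<^sup>2) \<partial>unit_interval 0)"
  proof (rule integral_mono)
    fix t assume "t \<in> space (unit_interval 0)"
    then have t: "- 1 \<le> - t" "- t \<le> 0" by auto
    have "A * (norm (C t))\<^sup>2 \<le> (\<Sum>r\<in>{0..<q}. (norm (zak (x + of_int r / of_int q) (- t)))\<^sup>2) * (norm (C t))\<^sup>2"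
      by (rule mult_right_mono[OF A[OF x t]]) simp
    also have "\<dots> = (\<Sum>r\<in>{0..<q}. (norm (\<Sum>j\<in>J. G r j * fchar j t))\<^sup>2)"
      by (simp add: conv norm_mult power_mult_distrib sum_distrib_left mult.commute)
    finally show "A * (norm (C t))\<^sup>2 \<le> (\<Sum>r\<in>{0..<q}. (norm (\<Sum>j\<in>J. G r j * fchar j t))\<^sup>2)" .
  qed (use intC in \<open>auto simp: C_def\<close>)
  also have "\<dots> = (\<Sum>r\<in>{0..<q}. \<Sum>j\<in>J. (norm (G r j))\<^sup>2)"
    by (simp add: Bochner_Integration.integral_sum intC trig_poly_norm J_def)
  finally show ?thesis unfolding G_def .
qed

lemma continuous_on_localized:
  "continuous_on UNIV h \<Longrightarrow> continuous_on UNIV (localized h m)"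
  unfolding localized_def
  by (intro continuous_intros continuous_on_compose2[OF continuous]) auto

text \<open>
  Integrate the correlation bound over one period. For a continuous function of compact support only
  finitely many translates contribute, so finitely many frequencies recover the integrals up to an
  arbitrary error.
\<close>

lemma gabor_lower_bound_continuous:
  assumes A: "\<And>y t. 0 \<le> y \<Longrightarrow> y \<le> 1 \<Longrightarrow> -1 \<le> t \<Longrightarrow> t \<le> 0 \<Longrightarrow> A \<le> (\<Sum>r\<in>{0..<q}. (norm (zak (y + of_int r / of_int q) t))\<^sup>2)"
    and h: "h \<in> L2" "continuous_on UNIV h" "\<And>x. \<bar>x\<bar> \<ge> of_int T \<Longrightarrow> h x = 0" and "T > 0"
  shows "A * (L2_norm h)\<^sup>2 \<le> (\<Sum>\<^sub>\<infinity>i. (norm (L2_inner h (\<phi> i)))\<^sup>2)"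
proof (rule field_le_epsilon)
  fix \<epsilon> :: real assume "\<epsilon> > 0"
  \<comment> \<open>One integer more than the support needs on either side makes the periodizations agree at \<open>0\<close> and
    \<open>1\<close>; translation indices are written as \<open>q * j - r\<close> with a remainder \<open>r\<close> below \<open>q\<close>.\<close>
  define W J where "W = {-(T + 1)..T + 1}" and "J = {-((T + 1) + L + 2)..(T + 1) + L + 2}"
  define I where "I = {0..<q} \<times> J"
  define H where "H = (\<lambda>(r, j). periodize W (localized h (q * j - r)))"
  define \<delta> where "\<delta> = \<epsilon> / (real (card I) + 1)"
  have fin: "finite W" "finite I" by (auto simp: W_def I_def J_def)
  have "\<delta> > 0" using \<open>\<epsilon> > 0\<close> by (simp add: \<delta>_def)
  have hsupp: "h x = 0" if "\<lfloor>x\<rfloor> \<notin> {-T..T - 1}" for x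
  proof (rule h(3))
    show "\<bar>x\<bar> \<ge> of_int T" using that by auto linarith+
  qed
  have W: "\<lfloor>x - 0\<rfloor> \<in> W" if "localized h m x \<noteq> 0" for m x
    using that hsupp[of x] by (force simp: localized_def W_def)
  have W': "\<lfloor>x - 0\<rfloor> \<in> W" if "h x \<noteq> 0" for x
    using that hsupp[of x] by (force simp: W_def)
  have H_cont: "continuous_on S (H i)" for S i
    unfolding H_def periodize_def split_beta
    by (intro continuous_intros continuous_on_compose2[OF continuous_on_localized[OF h(2)]]) auto
  have H_ends: "H i 0 = H i 1" for i
  proof -
    have z: "localized h m (of_int n) = 0" if "n \<notin> {-T..T - 1}" for m n
      using hsupp[of "of_int n"] that by (simp add: localized_def)
    have "periodize W (localized h m) 0 = (\<Sum>n\<in>{-T..T - 1}. localized h m (of_int n))" for m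
      unfolding periodize_def by (rule sum.mono_neutral_cong_right) (auto simp: W_def z)
    moreover have "periodize W (localized h m) 1 = (\<Sum>n\<in>{-T..T - 1}. localized h m (of_int n))" for m
    proof -
      have "periodize W (localized h m) 1 = (\<Sum>n\<in>{-T..T + 2}. localized h m (of_int n))"
        unfolding periodize_def W_def
        by (rule sum.reindex_bij_witness[of _ "\<lambda>n. n - 1" "\<lambda>n. n + 1"]) (auto simp: add.commute)
      also have "\<dots> = (\<Sum>n\<in>{-T..T - 1}. localized h m (of_int n))"
        by (rule sum.mono_neutral_right) (auto simp: z)
      finally show ?thesis .
    qed
    ultimately show ?thesis by (simp add: H_def split_beta)
  qed
  obtain K where K: "finite K"
    "\<And>i. i \<in> I \<Longrightarrow> (\<integral>x. (norm (H i x))\<^sup>2 \<partial>unit_interval 0) \<le> (\<Sum>k\<in>K. (norm (fcoeff 0 (H i) k))\<^sup>2) + \<delta>"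
    using parseval_approx[OF fin(2), of H \<delta>] H_cont H_ends \<open>\<delta> > 0\<close> by blast
  have coeff: "fcoeff 0 (H (r, j)) k = L2_inner h (\<phi> (k, q * j - r))" for r j k
    unfolding H_def inner_gabor_system split_conv
    by (rule fcoeff_periodize[OF localized_L2(2)[OF h(1)] fin(1) W])
  have int_H: "integrable (unit_interval 0) (\<lambda>x. (norm (H i x))\<^sup>2)" for i
    unfolding H_def split_beta
    by (rule square_integrable_periodize[OF localized_L2(2,3)[OF h(1)] fin(1) W])
  have inj: "inj_on (\<lambda>((r, j), k). (k, q * j - r)) (I \<times> K)"
  proof -
    have rj: "r = r' \<and> j = j'" if "q * j - r = q * j' - r'" "0 \<le> r" "r < q" "0 \<le> r'" "r' < q" for r r' j j' :: int
    proof -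
      have e: "r - r' = q * (j - j')" using that(1) by (simp add: algebra_simps)
      then have "q dvd r - r'" by simp
      moreover have "\<bar>r - r'\<bar> < q" using that by auto
      ultimately have "r - r' = 0" using zdvd_imp_le[of q "\<bar>r - r'\<bar>"] by (cases "r = r'") auto
      with e q_pos show ?thesis by simp
    qed
    show ?thesis
    proof (rule inj_onI)
      fix p p' assume p: "p \<in> I \<times> K" "p' \<in> I \<times> K"
        "(\<lambda>((r, j), k). (k, q * j - r)) p = (\<lambda>((r, j), k). (k, q * j - r)) p'"
      obtain r j k r' j' k' where "p = ((r, j), k)" "p' = ((r', j'), k')"
        by (metis prod.collapse)
      with p rj[of j r j' r'] show "p = p'" by (simp add: I_def)
    qed
  qed
  have "A * (L2_norm h)\<^sup>2 = (\<integral>x. A * periodize W (\<lambda>x. (norm (h x))\<^sup>2) x \<partial>unit_interval 0)"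
    using integral_periodize[of "\<lambda>x. (norm (h x))\<^sup>2" W 0] h(1) fin(1) W'
    by (simp add: L2_norm_squared L2_def)
  also have "\<dots> \<le> (\<integral>x. (\<Sum>i\<in>I. (norm (H i x))\<^sup>2) \<partial>unit_interval 0)"
  proof (rule integral_mono)
    show "integrable (unit_interval 0) (\<lambda>x. A * periodize W (\<lambda>x. (norm (h x))\<^sup>2) x)"
      using integrable_periodize[of "\<lambda>x. (norm (h x))\<^sup>2" W 0] h(1) fin(1) W' by (simp add: L2_def)
    fix x assume "x \<in> space (unit_interval 0)"
    then have x: "0 \<le> x" "x \<le> 1" by auto
    have H_eq: "H (r, j) x = (\<Sum>n\<in>{-(T+1)..T+1}. h (x + of_int n) * of_real (g (x + of_int r / of_int q + of_int (n - j))))" for r j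
    proof -
      have "x + of_int n - of_int (q * j - r) / of_int q = x + of_int r / of_int q + of_int (n - j)" for n
        using q_pos by (simp add: field_simps)
      then show ?thesis by (simp only: H_def periodize_def localized_def W_def split_conv)
    qed
    have "A * (\<Sum>n\<in>W. (norm (h (x + of_int n)))\<^sup>2) \<le> (\<Sum>r\<in>{0..<q}. \<Sum>j\<in>J. (norm (H (r, j) x))\<^sup>2)"
      unfolding H_eq W_def J_def by (rule correlation_lower_bound[OF A x])
    then show "A * periodize W (\<lambda>x. (norm (h x))\<^sup>2) x \<le> (\<Sum>i\<in>I. (norm (H i x))\<^sup>2)"
      by (simp add: periodize_def I_def sum.cartesian_product)
  qed (use int_H in auto)
  also have "\<dots> = (\<Sum>i\<in>I. \<integral>x. (norm (H i x))\<^sup>2 \<partial>unit_interval 0)"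
    using int_H by (simp add: Bochner_Integration.integral_sum)
  also have "\<dots> \<le> (\<Sum>i\<in>I. (\<Sum>k\<in>K. (norm (fcoeff 0 (H i) k))\<^sup>2) + \<delta>)"
    by (rule sum_mono) (rule K(2))
  also have "\<dots> = (\<Sum>i\<in>I. \<Sum>k\<in>K. (norm (fcoeff 0 (H i) k))\<^sup>2) + real (card I) * \<delta>"
    by (simp add: sum.distrib)
  also have "(\<Sum>i\<in>I. \<Sum>k\<in>K. (norm (fcoeff 0 (H i) k))\<^sup>2) =
      (\<Sum>p\<in>I \<times> K. (norm (L2_inner h (\<phi> ((\<lambda>((r, j), k). (k, q * j - r)) p))))\<^sup>2)"
    by (auto simp: sum.cartesian_product coeff intro!: sum.cong)
  also have "\<dots> = (\<Sum>i\<in>(\<lambda>((r, j), k). (k, q * j - r)) ` (I \<times> K). (norm (L2_inner h (\<phi> i)))\<^sup>2)"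
    by (subst sum.reindex[OF inj]) (simp add: o_def)
  also have "\<dots> \<le> (\<Sum>\<^sub>\<infinity>i. (norm (L2_inner h (\<phi> i)))\<^sup>2)"
    by (rule finite_sum_le_infsum) (use gabor_upper_bound h(1) fin K(1) in auto)
  also have "real (card I) * \<delta> \<le> \<epsilon>"
    using \<open>\<epsilon> > 0\<close> by (simp add: \<delta>_def field_simps)
  finally show "A * (L2_norm h)\<^sup>2 \<le> (\<Sum>\<^sub>\<infinity>i. (norm (L2_inner h (\<phi> i)))\<^sup>2) + \<epsilon>"
    by simp
qed

lemma inner_gabor_system_diff:
  assumes "f \<in> L2" "h \<in> L2"
  shows "L2_inner (\<lambda>x. f x - h x) (\<phi> i) = L2_inner f (\<phi> i) - L2_inner h (\<phi> i)"
proof -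
  obtain k m where i: "i = (k, m)" by (cases i)
  have int: "integrable lborel (\<lambda>x. localized u m x * fchar (- k) x)" if "u \<in> L2" for u
    by (rule Bochner_Integration.integrable_bound[OF localized_L2(2)[OF that]])
      (use localized_L2(2)[OF that] in \<open>auto simp: norm_mult\<close>)
  have "localized (\<lambda>x. f x - h x) m x * fchar (- k) x = localized f m x * fchar (- k) x - localized h m x * fchar (- k) x" for x
    by (simp add: localized_def algebra_simps)
  then show ?thesis
    unfolding i inner_gabor_system using int assms by simp
qed

text \<open>
  Approximating by continuous functions costs only a constant factor, because the analysis map is
  already known to be bounded.
\<close>

lemma gabor_lower_bound:
  assumes zak_nonvanishing
  obtains A where "A > 0"
    "\<And>f. f \<in> L2 \<Longrightarrow> A * (L2_norm f)\<^sup>2 \<le> (\<Sum>\<^sub>\<infinity>i. (norm (L2_inner f (\<phi> i)))\<^sup>2)"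
proof -
  let ?S = "\<lambda>f. \<Sum>\<^sub>\<infinity>i. (norm (L2_inner f (\<phi> i)))\<^sup>2"
  obtain A where A: "A > 0"
    "\<And>y t. 0 \<le> y \<Longrightarrow> y \<le> 1 \<Longrightarrow> -1 \<le> t \<Longrightarrow> t \<le> 0 \<Longrightarrow> A \<le> (\<Sum>r\<in>{0..<q}. (norm (zak (y + of_int r / of_int q) t))\<^sup>2)"
    using zak_uniform_lower_bound[OF assms] by blast
  obtain B where B: "B > 0"
    "\<And>f. f \<in> L2 \<Longrightarrow> (\<lambda>i. (norm (L2_inner f (\<phi> i)))\<^sup>2) summable_on UNIV"
    "\<And>f. f \<in> L2 \<Longrightarrow> ?S f \<le> B * (L2_norm f)\<^sup>2"
    using gabor_upper_bound by blast
  have "A / 4 * (L2_norm f)\<^sup>2 \<le> ?S f" if f: "f \<in> L2" for f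
  proof (rule field_le_epsilon)
    fix \<epsilon> :: real assume "\<epsilon> > 0"
    define \<delta> where "\<delta> = \<epsilon> / (A + B)"
    have "\<delta> > 0" using \<open>\<epsilon> > 0\<close> A(1) B(1) by (simp add: \<delta>_def)
    obtain h T where h: "continuous_on UNIV h" "\<And>x. \<bar>x\<bar> \<ge> of_int T \<Longrightarrow> h x = 0" "T > 0" "h \<in> L2"
      "(L2_norm (\<lambda>x. f x - h x))\<^sup>2 < \<delta>"
      using L2_continuous_dense[OF f \<open>\<delta> > 0\<close>] by blast
    have fh: "(\<lambda>x. f x - h x) \<in> L2" by (rule L2_diff[OF f h(4)])
    have "(norm (L2_inner h (\<phi> i)))\<^sup>2 \<le> 2 * (norm (L2_inner f (\<phi> i)))\<^sup>2 + 2 * (norm (L2_inner (\<lambda>x. f x - h x) (\<phi> i)))\<^sup>2" for i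
    proof -
      let ?a = "L2_inner f (\<phi> i)" and ?b = "L2_inner (\<lambda>x. f x - h x) (\<phi> i)"
      have "L2_inner h (\<phi> i) = ?a - ?b"
        by (simp add: inner_gabor_system_diff[OF f h(4)])
      then show ?thesis
        using power_mono[OF norm_triangle_ineq4[of ?a ?b], of 2] sum_squares_bound[of "norm ?a" "norm ?b"]
        by (simp add: power2_sum)
    qed
    then have "?S h \<le> (\<Sum>\<^sub>\<infinity>i. 2 * (norm (L2_inner f (\<phi> i)))\<^sup>2 + 2 * (norm (L2_inner (\<lambda>x. f x - h x) (\<phi> i)))\<^sup>2)"
      by (intro infsum_mono summable_on_add summable_on_cmult_right B(2) f fh h(4))
    also have "\<dots> = 2 * ?S f + 2 * ?S (\<lambda>x. f x - h x)"
      by (subst infsum_add) (simp_all add: summable_on_cmult_right B(2) f fh infsum_cmult_right)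
    finally have 1: "?S h \<le> 2 * ?S f + 2 * ?S (\<lambda>x. f x - h x)" .
    have 2: "?S (\<lambda>x. f x - h x) \<le> B * \<delta>"
      using B(3)[OF fh] h(5) B(1) by (meson less_imp_le mult_left_mono order_trans)
    have 3: "A * (L2_norm h)\<^sup>2 \<le> ?S h"
      by (rule gabor_lower_bound_continuous[OF A(2) h(4,1,2,3)])
    have "(L2_norm (\<lambda>x. h x + (f x - h x)))\<^sup>2 \<le> 2 * (L2_norm h)\<^sup>2 + 2 * (L2_norm (\<lambda>x. f x - h x))\<^sup>2"
      by (rule L2_add_le(2)[OF h(4) fh])
    then have "(L2_norm f)\<^sup>2 \<le> 2 * (L2_norm h)\<^sup>2 + 2 * \<delta>"
      using h(5) by simp
    then have *: "A * (L2_norm f)\<^sup>2 \<le> A * (2 * (L2_norm h)\<^sup>2 + 2 * \<delta>)"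
      by (rule mult_left_mono) (use A(1) in simp)
    then have "A * (L2_norm f)\<^sup>2 \<le> 4 * ?S f + 4 * ((A + B) * \<delta>)"
    proof -
      have "A * (2 * (L2_norm h)\<^sup>2 + 2 * \<delta>) = 2 * (A * (L2_norm h)\<^sup>2) + 2 * (A * \<delta>)"
        "(A + B) * \<delta> = A * \<delta> + B * \<delta>"
        by (simp_all add: algebra_simps)
      moreover note mult_pos_pos[OF A(1) \<open>\<delta> > 0\<close>]
      ultimately show ?thesis using 1 2 3 * by linarith
    qed
    moreover have "(A + B) * \<delta> = \<epsilon>" using A(1) B(1) by (simp add: \<delta>_def)
    ultimately show "A / 4 * (L2_norm f)\<^sup>2 \<le> ?S f + \<epsilon>" by simp
  qed
  then show thesis using that[of "A / 4"] A(1) by simp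
qed

lemma isCont_zak: "isCont (\<lambda>y. zak y t) y"
proof -
  define M where "M = \<lceil>\<bar>y\<bar>\<rceil> + 1"
  have "continuous_on {- of_int M..of_int M} (\<lambda>y. zak y t)"
    using continuous_on_compose2[OF continuous_on_zak[of M], of "{- of_int M..of_int M}" "\<lambda>y. (y, t)"]
    by (auto simp: continuous_intros)
  moreover have "- of_int M < y" "y < of_int M"
    unfolding M_def by linarith+
  ultimately show ?thesis
    by (intro continuous_on_interior) auto
qed

lemma partial_zak_bound:
  assumes "finite W" "\<And>x. \<bar>g x\<bar> \<le> G" "G > 0"
  shows "norm (\<Sum>n\<in>W. of_real (g (y + of_int n)) * fchar n t) \<le> of_int (2 * L + 2) * G"
proof -
  let ?J = "{\<lfloor>- y\<rfloor> - L..\<lfloor>- y\<rfloor> + L + 1}"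
  have J: "n \<in> ?J" if "g (y + of_int n) \<noteq> 0" for n
  proof -
    have "\<bar>y + of_int n\<bar> < of_int L" using that support not_le by blast
    then show ?thesis by auto linarith+
  qed
  have "(\<Sum>n\<in>W. of_real (g (y + of_int n)) * fchar n t) = (\<Sum>n\<in>W \<inter> ?J. of_real (g (y + of_int n)) * fchar n t)"
    by (rule sum.mono_neutral_right) (use assms(1) J in auto)
  also have "norm \<dots> \<le> (\<Sum>n\<in>W \<inter> ?J. \<bar>g (y + of_int n)\<bar>)"
    by (rule order_trans[OF norm_sum]) (simp add: norm_mult)
  also have "\<dots> \<le> (\<Sum>n\<in>?J. \<bar>g (y + of_int n)\<bar>)"
    by (rule sum_mono2) auto
  also have "\<dots> \<le> (\<Sum>n\<in>?J. G)" by (rule sum_mono) (rule assms(2))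
  also have "\<dots> = of_int (2 * L + 2) * G" using L_pos by simp
  finally show ?thesis .
qed

text \<open>
  A common zero \<open>(y, t)\<close> defeats every lower bound: a train of \<open>2T + 1\<close> short bumps at the points
  \<open>y + n\<close>, with phases \<open>fchar n t\<close>, correlates with a translate of the window like a value of the Zak
  transform near a zero, except for the translates at the two ends of the train. Their number
  does not depend on \<open>T\<close>, whereas the energy of the train is proportional to \<open>2T + 1\<close>.
\<close>

lemma frame_imp_zak_nonvanishing:
  assumes "L2_frame \<phi>"
  shows zak_nonvanishing
proof (rule ccontr)
  assume "\<not> zak_nonvanishing"
  then obtain y' t where zero': "\<And>m::int. zak (y' + of_int m / of_int q) t = 0"
    unfolding zak_nonvanishing_def by blast
  define y where "y = frac y'"
  have zero: "zak (y - of_int m / of_int q) t = 0" for m :: int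
  proof -
    have "y - of_int m / of_int q = (y' + of_int (- m) / of_int q) + of_int (- \<lfloor>y'\<rfloor>)"
      by (simp add: y_def frac_def)
    then show ?thesis by (simp only: zak_add_int zero') simp
  qed
  have y: "0 \<le> y" "y < 1" by (simp_all add: y_def frac_lt_1)
  obtain A where A: "A > 0" and summable: "\<And>f. f \<in> L2 \<Longrightarrow> (\<lambda>i. (norm (L2_inner f (\<phi> i)))\<^sup>2) summable_on UNIV"
    and lower: "\<And>f. f \<in> L2 \<Longrightarrow> A * (L2_norm f)\<^sup>2 \<le> (\<Sum>\<^sub>\<infinity>i. (norm (L2_inner f (\<phi> i)))\<^sup>2)"
    using assms unfolding L2_frame_def by blast
  obtain G where G: "G > 0" "\<And>x. \<bar>g x\<bar> \<le> G" using window_bounded by blast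
  define C where "C = (of_int (2 * L + 2) * G)\<^sup>2"
  define D where "D = of_int (2 * (q * (2 * L + 4))) * C"
  have "C \<ge> 0" by (simp add: C_def)
  have "D \<ge> 0" unfolding D_def using \<open>C \<ge> 0\<close> q_pos L_pos by (intro mult_nonneg_nonneg) auto
  \<comment> \<open>In units of the length of a bump, \<open>D\<close> bounds the contribution of the translates at the two ends,
    all others together will contribute at most \<open>1\<close>, and the energy of the train, \<open>2T + 1\<close>, has to
    exceed \<open>(D + 1) / A\<close>.\<close>
  define T where "T = \<lceil>(D + 1) / A\<rceil> + L + 2"
  have T_large: "(D + 1) / A < 2 * of_int T + 1" and T: "L + 2 \<le> T"
  proof -
    have "(D + 1) / A \<ge> 0" using A \<open>D \<ge> 0\<close> by simp
    then have "\<lceil>(D + 1) / A\<rceil> \<ge> 0" by linarith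
    then show "L + 2 \<le> T" by (simp add: T_def)
    have "(D + 1) / A \<le> of_int T" unfolding T_def using L_pos by linarith
    then show "(D + 1) / A < 2 * of_int T + 1" using \<open>(D + 1) / A \<ge> 0\<close> by linarith
  qed
  define W where "W = {-T..T}"
  \<comment> \<open>Translates up to \<open>p\<close> lie entirely inside the train, those beyond \<open>p'\<close> miss it.\<close>
  define p where "p = q * (T - L - 2)"
  define p' where "p' = q * (T + L + 2)"
  have pp': "0 \<le> p" "p \<le> p'" "p' - p = q * (2 * L + 4)"
  proof -
    show "0 \<le> p" unfolding p_def using T q_pos by (intro mult_nonneg_nonneg) auto
    show "p' - p = q * (2 * L + 4)" by (simp add: p_def p'_def algebra_simps)
    moreover have "0 \<le> q * (2 * L + 4)" using L_pos q_pos by (intro mult_nonneg_nonneg) auto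
    ultimately show "p \<le> p'" by linarith
  qed
  define \<eta> where "\<eta> = 1 / sqrt (2 * of_int p + 1)"
  have "\<eta> > 0" using pp' by (simp add: \<eta>_def)
  have \<eta>: "of_int (2 * p + 1) * \<eta>\<^sup>2 = 1" using pp' by (simp add: \<eta>_def power_divide)
  have "\<forall>\<^sub>F x in nhds y. \<forall>m\<in>{-p..p}. norm (zak (x - of_int m / of_int q) t) < \<eta>"
  proof (rule eventually_ball_finite)
    show "\<forall>m\<in>{-p..p}. \<forall>\<^sub>F x in nhds y. norm (zak (x - of_int m / of_int q) t) < \<eta>"
    proof
      fix m
      have "isCont (\<lambda>x. zak (x - of_int m / of_int q) t) y"
        by (rule isCont_o2[OF _ isCont_zak]) (intro continuous_intros)
      then have "isCont (\<lambda>x. norm (zak (x - of_int m / of_int q) t)) y"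
        by (rule continuous_norm)
      then have "((\<lambda>x. norm (zak (x - of_int m / of_int q) t)) \<longlongrightarrow> norm (zak (y - of_int m / of_int q) t)) (nhds y)"
        unfolding isCont_def
        using tendsto_at_iff_tendsto_nhds[of "\<lambda>x. norm (zak (x - of_int m / of_int q) t)" y] by simp
      from order_tendstoD(2)[OF this] show "\<forall>\<^sub>F x in nhds y. norm (zak (x - of_int m / of_int q) t) < \<eta>"
        using zero \<open>\<eta> > 0\<close> by simp
    qed
  qed simp
  then obtain d where d: "d > 0" "\<And>x m. dist x y < d \<Longrightarrow> m \<in> {-p..p} \<Longrightarrow> norm (zak (x - of_int m / of_int q) t) < \<eta>"
    unfolding eventually_nhds_metric by blast
  define \<epsilon> where "\<epsilon> = min d 1"
  have \<epsilon>: "0 < \<epsilon>" "\<epsilon> \<le> 1" "\<epsilon> \<le> d" using d(1) by (auto simp: \<epsilon>_def)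
  define f where "f x = (\<Sum>n\<in>W. fchar n t * indicator {y + of_int n..<y + of_int n + \<epsilon>} x)" for x
  have f_floor: "\<lfloor>x - y\<rfloor> \<in> W" if "f x \<noteq> 0" for x
  proof -
    have "\<exists>n\<in>W. fchar n t * indicator {y + of_int n..<y + of_int n + \<epsilon>} x \<noteq> 0"
      using that unfolding f_def by (rule sum.not_neutral_contains_not_neutral) blast
    then obtain n where n: "n \<in> W" "x \<in> {y + of_int n..<y + of_int n + \<epsilon>}"
      by (auto simp: indicator_def split: if_splits)
    then have "\<lfloor>x - y\<rfloor> = n" using \<epsilon>(2) by (auto simp: floor_eq_iff)
    with n show ?thesis by simp
  qed
  have f_val: "f (x + of_int n) = fchar n t * indicator {y..<y + \<epsilon>} x" if x: "y \<le> x" "x < y + 1" and n: "n \<in> W" for x n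
  proof -
    have "(indicator {y + of_int k..<y + of_int k + \<epsilon>} (x + of_int n) :: complex) = (if k = n then indicator {y..<y + \<epsilon>} x else 0)" for k
    proof (cases "k = n")
      case False
      have "x + of_int n \<notin> {y + of_int k..<y + of_int k + \<epsilon>}"
      proof
        assume "x + of_int n \<in> {y + of_int k..<y + of_int k + \<epsilon>}"
        then have "of_int k < of_int n + (1::real)" "of_int n < of_int k + (1::real)"
          using x \<epsilon>(2) by auto
        then show False using False by linarith
      qed
      then show ?thesis using False by simp
    qed (auto simp: indicator_def)
    then have "f (x + of_int n) = (\<Sum>k\<in>W. if k = n then fchar n t * indicator {y..<y + \<epsilon>} x else 0)"
      unfolding f_def by (intro sum.cong) auto
    then show ?thesis using n by (simp add: W_def)
  qed
  have fL: "f \<in> L2"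
  proof (rule L2_bounded_support(1))
    show "f \<in> borel_measurable borel" unfolding f_def by measurable
    show "norm (f x) \<le> (\<Sum>n\<in>W. 1)" for x
      unfolding f_def by (rule order_trans[OF norm_sum sum_mono]) (auto simp: norm_mult indicator_def)
    show "f x = 0" if "x \<notin> {y - of_int T..y + of_int T + 1}" for x
    proof (rule ccontr)
      assume "f x \<noteq> 0"
      from f_floor[OF this] that show False by (auto simp: W_def) linarith+
    qed
  qed
  have finW: "finite W" by (simp add: W_def)
  have norm_f: "(L2_norm f)\<^sup>2 = (2 * of_int T + 1) * \<epsilon>"
  proof -
    have "(L2_norm f)\<^sup>2 = (\<integral>x. periodize W (\<lambda>x. (norm (f x))\<^sup>2) x \<partial>unit_interval y)"
      using integral_periodize[of "\<lambda>x. (norm (f x))\<^sup>2" W y] fL finW f_floor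
      by (simp add: L2_norm_squared L2_def)
    also have "\<dots> = (\<integral>x. (2 * of_int T + 1) * indicator {y..<y + \<epsilon>} x \<partial>unit_interval y)"
    proof (rule Bochner_Integration.integral_cong)
      fix x assume "x \<in> space (unit_interval y)"
      then have "periodize W (\<lambda>x. (norm (f x))\<^sup>2) x = (\<Sum>n\<in>W. indicator {y..<y + \<epsilon>} x)"
        unfolding periodize_def by (intro sum.cong) (auto simp: f_val norm_mult indicator_def)
      also have "\<dots> = (2 * of_int T + 1) * indicator {y..<y + \<epsilon>} x"
        using T L_pos by (simp add: W_def)
      finally show "periodize W (\<lambda>x. (norm (f x))\<^sup>2) x = (2 * of_int T + 1) * indicator {y..<y + \<epsilon>} x" .
    qed simp
    also have "\<dots> = (2 * of_int T + 1) * \<epsilon>"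
      using integral_initial_segment[OF \<epsilon>(1,2), of y] by simp
    finally show ?thesis .
  qed
  \<comment> \<open>A bound for the squared correlation with the translate of index \<open>m\<close>.\<close>
  define \<beta> where "\<beta> m = (if m \<in> {-p..p} then \<eta>\<^sup>2 else 0) + (if m \<in> {-p'..-(p+1)} \<union> {p+1..p'} then C else 0)" for m
  have \<beta>_nonneg: "\<beta> m \<ge> 0" for m using \<open>C \<ge> 0\<close> by (simp add: \<beta>_def)
  have correlation: "(norm (periodize W (localized f m) x))\<^sup>2 \<le> \<beta> m * indicator {y..<y + \<epsilon>} x"
    if x: "y \<le> x" "x < y + 1" for m x
  proof -
    let ?P = "\<Sum>n\<in>W. of_real (g ((x - of_int m / of_int q) + of_int n)) * fchar n t"
    have per: "periodize W (localized f m) x = indicator {y..<y + \<epsilon>} x * ?P"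
      unfolding periodize_def localized_def sum_distrib_left
      by (rule sum.cong) (simp_all add: f_val[OF x] algebra_simps)
    have near: "\<bar>x - of_int m / of_int q + of_int n\<bar> < of_int L" if "g ((x - of_int m / of_int q) + of_int n) \<noteq> 0" for n
      using that support not_le by blast
    have "(norm ?P)\<^sup>2 \<le> \<beta> m" if xe: "x < y + \<epsilon>"
    proof -
      consider "m \<in> {-p..p}" | "m \<in> {-p'..-(p+1)} \<union> {p+1..p'}" | "m < - p' \<or> p' < m"
        by force
      then show ?thesis
      proof cases
        case 1
        have "zak (x - of_int m / of_int q) t = ?P"
        proof (rule zak_eq_sum[OF finW])
          fix n assume "g ((x - of_int m / of_int q) + of_int n) \<noteq> 0"
          from near[OF this] have n: "\<bar>x - of_int m / of_int q + of_int n\<bar> < of_int L" .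
          have "\<bar>real_of_int m\<bar> \<le> of_int p"
            using 1 by auto
          then have "\<bar>real_of_int m\<bar> \<le> of_int q * of_int (T - L - 2)"
            by (simp only: p_def of_int_mult)
          then have "\<bar>of_int m / real_of_int q\<bar> \<le> of_int (T - L - 2)"
            using q_pos by (simp add: pos_divide_le_eq mult.commute)
          then have "- T \<le> n \<and> n \<le> T" using n x y by linarith
          then show "n \<in> W" by (simp add: W_def)
        qed
        moreover have "norm (zak (x - of_int m / of_int q) t) < \<eta>"
          by (rule d(2)[OF _ 1]) (use x xe \<epsilon>(3) in \<open>auto simp: dist_real_def\<close>)
        ultimately have "(norm ?P)\<^sup>2 \<le> \<eta>\<^sup>2" by (intro power_mono) auto
        then show ?thesis using \<open>C \<ge> 0\<close> 1 by (simp add: \<beta>_def)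
      next
        case 2
        have "(norm ?P)\<^sup>2 \<le> C"
          unfolding C_def by (intro power_mono partial_zak_bound finW G) simp
        also have "C \<le> \<beta> m" using 2 by (auto simp: \<beta>_def)
        finally show ?thesis .
      next
        case 3
        have "g ((x - of_int m / of_int q) + of_int n) = 0" if "n \<in> W" for n
        proof (rule ccontr)
          assume "g ((x - of_int m / of_int q) + of_int n) \<noteq> 0"
          from near[OF this] have n: "\<bar>x - of_int m / of_int q + of_int n\<bar> < of_int L" .
          have "real_of_int p' \<le> \<bar>of_int m\<bar>" using 3 by linarith
          then have "real_of_int q * of_int (T + L + 2) \<le> \<bar>of_int m\<bar>"
            by (simp only: p'_def of_int_mult)
          then have "of_int (T + L + 2) \<le> \<bar>of_int m / real_of_int q\<bar>"
            using q_pos by (simp add: pos_le_divide_eq mult.commute)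
          moreover have "- T \<le> n" "n \<le> T" using that by (simp_all add: W_def)
          ultimately show False using n x y by linarith
        qed
        then have "?P = 0" by (intro sum.neutral) auto
        then show ?thesis using \<beta>_nonneg by simp
      qed
    qed
    then show ?thesis
      using x by (auto simp: per indicator_def)
  qed
  have energy: "(\<Sum>i\<in>F. (norm (L2_inner f (\<phi> i)))\<^sup>2) \<le> (1 + D) * \<epsilon>" if F: "finite F" for F
  proof -
    define K M where "K = fst ` F" and "M = snd ` F"
    have KM: "finite K" "finite M" "F \<subseteq> K \<times> M" using F by (force simp: K_def M_def)+
    have "(\<Sum>i\<in>F. (norm (L2_inner f (\<phi> i)))\<^sup>2) \<le> (\<Sum>i\<in>K \<times> M. (norm (L2_inner f (\<phi> i)))\<^sup>2)"
      by (rule sum_mono2) (use KM in auto)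
    also have "\<dots> = (\<Sum>m\<in>M. \<Sum>k\<in>K. (norm (L2_inner f (\<phi> (k, m))))\<^sup>2)"
      by (subst sum.swap) (simp add: sum.cartesian_product)
    also have "\<dots> \<le> (\<Sum>m\<in>M. \<beta> m * \<epsilon>)"
    proof (rule sum_mono)
      fix m
      have W: "\<lfloor>x - y\<rfloor> \<in> W" if "localized f m x \<noteq> 0" for x
        using that f_floor[of x] by (auto simp: localized_def)
      have "(\<Sum>k\<in>K. (norm (L2_inner f (\<phi> (k, m))))\<^sup>2)
          \<le> (\<integral>x. (norm (periodize W (localized f m) x))\<^sup>2 \<partial>unit_interval y)"
        by (rule bessel_gabor_system[OF fL finW W KM(1)])
      also have "\<dots> \<le> (\<integral>x. \<beta> m * indicator {y..<y + \<epsilon>} x \<partial>unit_interval y)"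
        by (rule integral_mono)
          (use integral_initial_segment(2)[OF \<epsilon>(1,2), of y] correlation
            square_integrable_periodize[OF localized_L2(2,3)[OF fL] finW W] in auto)
      also have "\<dots> = \<beta> m * \<epsilon>"
        using integral_initial_segment(1)[OF \<epsilon>(1,2), of y] by simp
      finally show "(\<Sum>k\<in>K. (norm (L2_inner f (\<phi> (k, m))))\<^sup>2) \<le> \<beta> m * \<epsilon>" .
    qed
    also have "\<dots> = (\<Sum>m\<in>M. \<beta> m) * \<epsilon>" by (simp add: sum_distrib_right)
    also have "\<dots> \<le> (1 + D) * \<epsilon>"
    proof (rule mult_right_mono)
      have "(\<Sum>m\<in>M. \<beta> m) = (\<Sum>m\<in>M \<inter> {-p'..p'}. \<beta> m)"
        by (rule sum.mono_neutral_right) (use KM(2) pp' in \<open>auto simp: \<beta>_def\<close>)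
      also have "\<dots> \<le> (\<Sum>m\<in>{-p'..p'}. \<beta> m)"
        by (rule sum_mono2) (use \<beta>_nonneg in auto)
      also have "\<dots> = (\<Sum>m\<in>{-p..p}. \<eta>\<^sup>2) + (\<Sum>m\<in>{-p'..-(p+1)} \<union> {p+1..p'}. C)"
      proof -
        have "{-p'..p'} \<inter> {-p..p} = {-p..p}" "{-p'..p'} \<inter> ({-p'..-(p+1)} \<union> {p+1..p'}) = {-p'..-(p+1)} \<union> {p+1..p'}"
          using pp' by auto
        then show ?thesis
          unfolding \<beta>_def sum.distrib by (simp only: sum.inter_restrict[symmetric] finite_atLeastAtMost_int)
      qed
      also have "(\<Sum>m\<in>{-p..p}. \<eta>\<^sup>2) = 1"
        using \<eta> pp' by simp
      also have "(\<Sum>m\<in>{-p'..-(p+1)} \<union> {p+1..p'}. C) = D"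
      proof -
        have "card ({-p'..-(p+1)} \<union> {p+1..p'}) = card {-p'..-(p+1)} + card {p+1..p'}"
          by (rule card_Un_disjoint) (use pp' in auto)
        also have "int \<dots> = 2 * (p' - p)" using pp'(2) by simp
        finally have "real (card ({-p'..-(p+1)} \<union> {p+1..p'})) = of_int (2 * (p' - p))"
          by (metis of_int_of_nat_eq)
        then show ?thesis by (simp only: sum_constant D_def pp'(3))
      qed
      finally show "(\<Sum>m\<in>M. \<beta> m) \<le> 1 + D" .
    qed (use \<epsilon> in simp)
    finally show ?thesis .
  qed
  have "A * ((2 * of_int T + 1) * \<epsilon>) \<le> (1 + D) * \<epsilon>"
    using lower[OF fL] infsum_le_finite_sums[OF summable[OF fL] energy] unfolding norm_f by linarith
  then have "A * (2 * of_int T + 1) \<le> 1 + D"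
    using \<epsilon>(1) by (simp add: mult.assoc[symmetric])
  then show False
    using T_large A by (simp add: pos_divide_less_eq mult.commute)
qed

theorem frame_iff_zak_nonvanishing: "L2_frame \<phi> \<longleftrightarrow> zak_nonvanishing"
proof
  assume zak_nonvanishing
  obtain A where A: "A > 0" "\<And>f. f \<in> L2 \<Longrightarrow> A * (L2_norm f)\<^sup>2 \<le> (\<Sum>\<^sub>\<infinity>i. (norm (L2_inner f (\<phi> i)))\<^sup>2)"
    using gabor_lower_bound[OF \<open>zak_nonvanishing\<close>] by blast
  obtain B where "B > 0"
    "\<And>f. f \<in> L2 \<Longrightarrow> (\<lambda>i. (norm (L2_inner f (\<phi> i)))\<^sup>2) summable_on UNIV"
    "\<And>f. f \<in> L2 \<Longrightarrow> (\<Sum>\<^sub>\<infinity>i. (norm (L2_inner f (\<phi> i)))\<^sup>2) \<le> B * (L2_norm f)\<^sup>2"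
    using gabor_upper_bound by blast
  with A show "L2_frame \<phi>"
    unfolding L2_frame_def using gabor_system_L2 by blast
qed (rule frame_imp_zak_nonvanishing)

end

section \<open>Dilations\<close>

lemma
  assumes "c > 0" "f \<in> L2"
  shows L2_dilate: "(\<lambda>x. f (c * x)) \<in> L2"
    and L2_norm_dilate: "(L2_norm (\<lambda>x. f (c * x)))\<^sup>2 = (L2_norm f)\<^sup>2 / c"
proof -
  have [measurable]: "f \<in> borel_measurable borel" and sq: "integrable lborel (\<lambda>x. (norm (f x))\<^sup>2)"
    using assms(2) by (auto simp: L2_def)
  have "integrable lborel (\<lambda>x. (norm (f (c * x)))\<^sup>2)"
    using lborel_integrable_real_affine[OF sq, of c 0] assms(1) by simp
  then show "(\<lambda>x. f (c * x)) \<in> L2" by (simp add: L2_def)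
  show "(L2_norm (\<lambda>x. f (c * x)))\<^sup>2 = (L2_norm f)\<^sup>2 / c"
    using lborel_integral_real_affine[of c "\<lambda>x. (norm (f x))\<^sup>2" 0] assms(1)
    by (simp add: L2_norm_squared)
qed

lemma L2_frame_dilate:
  assumes "c > 0" "L2_frame (gabor_system g a b)"
  shows "L2_frame (gabor_system (\<lambda>x. g (c * x)) (a / c) (b * c))"
proof -
  let ?\<phi> = "gabor_system g a b" and ?\<psi> = "gabor_system (\<lambda>x. g (c * x)) (a / c) (b * c)"
  have \<psi>: "?\<psi> i = (\<lambda>x. ?\<phi> i (c * x))" for i
  proof -
    obtain k m where "i = (k, m)" by (cases i)
    then show ?thesis
      using assms(1) by (simp add: gabor_system_def fun_eq_iff right_diff_distrib mult_ac)
  qed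
  obtain A B where \<phi>L: "\<And>i. ?\<phi> i \<in> L2" and AB: "A > 0" "B > 0"
    and frame: "\<And>f. f \<in> L2 \<Longrightarrow> (\<lambda>i. (norm (L2_inner f (?\<phi> i)))\<^sup>2) summable_on UNIV"
      "\<And>f. f \<in> L2 \<Longrightarrow> A * (L2_norm f)\<^sup>2 \<le> (\<Sum>\<^sub>\<infinity>i. (norm (L2_inner f (?\<phi> i)))\<^sup>2)"
      "\<And>f. f \<in> L2 \<Longrightarrow> (\<Sum>\<^sub>\<infinity>i. (norm (L2_inner f (?\<phi> i)))\<^sup>2) \<le> B * (L2_norm f)\<^sup>2"
    using assms(2) unfolding L2_frame_def by blast
  have inner: "(norm (L2_inner f (?\<psi> i)))\<^sup>2 = 1 / c\<^sup>2 * (norm (L2_inner (\<lambda>x. f (1 / c * x)) (?\<phi> i)))\<^sup>2" for f i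
  proof -
    have "L2_inner (\<lambda>x. f (1 / c * x)) (?\<phi> i) = c *\<^sub>R L2_inner f (?\<psi> i)"
      unfolding L2_inner_def \<psi> using assms(1)
      by (subst lborel_integral_real_affine[where c = c and t = 0]) auto
    then show ?thesis using assms(1) by (simp add: power_mult_distrib)
  qed
  have dil: "(\<lambda>x. f (1 / c * x)) \<in> L2" "(L2_norm (\<lambda>x. f (1 / c * x)))\<^sup>2 = c * (L2_norm f)\<^sup>2" if "f \<in> L2" for f
    using L2_dilate[of "1 / c" f] L2_norm_dilate[of "1 / c" f] assms(1) that by simp_all
  have inf: "(\<Sum>\<^sub>\<infinity>i. (norm (L2_inner f (?\<psi> i)))\<^sup>2) = 1 / c\<^sup>2 * (\<Sum>\<^sub>\<infinity>i. (norm (L2_inner (\<lambda>x. f (1 / c * x)) (?\<phi> i)))\<^sup>2)"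
    if "f \<in> L2" for f
    unfolding inner by (rule infsum_cmult_right) (use frame(1)[OF dil(1)[OF that]] in simp)
  show ?thesis
    unfolding L2_frame_def
  proof (intro conjI allI exI ballI)
    show "?\<psi> i \<in> L2" for i unfolding \<psi> by (rule L2_dilate[OF assms(1) \<phi>L])
    show "A / c > 0" "B / c > 0" using AB assms(1) by simp_all
    fix f :: "real \<Rightarrow> complex" assume f: "f \<in> L2"
    show "(\<lambda>i. (norm (L2_inner f (?\<psi> i)))\<^sup>2) summable_on UNIV"
      unfolding inner by (rule summable_on_cmult_right) (rule frame(1)[OF dil(1)[OF f]])
    have scale: "1 / c\<^sup>2 * (D * (c * N)) = D / c * N" for D N :: real
      using assms(1) by (simp add: power2_eq_square)
    show "A / c * (L2_norm f)\<^sup>2 \<le> (\<Sum>\<^sub>\<infinity>i. (norm (L2_inner f (?\<psi> i)))\<^sup>2)"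
      using mult_left_mono[OF frame(2)[OF dil(1)[OF f]], of "1 / c\<^sup>2"] unfolding inf[OF f] dil(2)[OF f] scale by simp
    show "(\<Sum>\<^sub>\<infinity>i. (norm (L2_inner f (?\<psi> i)))\<^sup>2) \<le> B / c * (L2_norm f)\<^sup>2"
      using mult_left_mono[OF frame(3)[OF dil(1)[OF f]], of "1 / c\<^sup>2"] unfolding inf[OF f] dil(2)[OF f] scale by simp
  qed
qed

corollary L2_frame_dilate_iff:
  assumes "c > 0"
  shows "L2_frame (gabor_system (\<lambda>x. g (c * x)) (a / c) (b * c)) \<longleftrightarrow> L2_frame (gabor_system g a b)"
proof
  assume "L2_frame (gabor_system (\<lambda>x. g (c * x)) (a / c) (b * c))"
  from L2_frame_dilate[OF _ this, of "1 / c"] assms show "L2_frame (gabor_system g a b)" by simp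
qed (rule L2_frame_dilate[OF assms])

section \<open>The Zak transform of a tent\<close>

text \<open>
  For \<open>z \<noteq> 1\<close> this is the Green function of the second derivative among the functions with
  \<open>u (t + 1) = u t / z\<close>: it is continuous, affine between consecutive integers, and its slope jumps by
  \<open>z powi (- n)\<close> at \<open>n\<close>. The Zak transform of any compactly supported continuous piecewise linear function is a
  combination of its translates.
\<close>

definition green :: "complex \<Rightarrow> real \<Rightarrow> complex" where
  "green z t = z powi (- \<lfloor>t\<rfloor>) * (z / (1 - z)\<^sup>2 + of_real (frac t) / (1 - z))"

lemma green_add_int:
  assumes "z \<noteq> 0"
  shows "green z (t + of_int n) = z powi (- n) * green z t"
proof -
  have "- \<lfloor>t + of_int n\<rfloor> = - n + - \<lfloor>t\<rfloor>" by simp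
  then have "z powi (- \<lfloor>t + of_int n\<rfloor>) = z powi (- n) * z powi (- \<lfloor>t\<rfloor>)"
    by (simp only: power_int_add[OF disjI1[OF assms]])
  then show ?thesis by (simp add: green_def frac_def)
qed

text \<open>
  The terms \<open>(t + k) z\<^sup>k\<close> have an explicit primitive in \<open>k\<close>. Summing the one-sided ramp therefore leaves
  \<open>green z t\<close> from the lower end and, from the upper end, a term affine in \<open>t\<close>, which every second
  difference kills.
\<close>

lemma green_sum:
  assumes z: "z \<noteq> 0" "z \<noteq> 1" and t: "\<bar>t\<bar> \<le> of_int M"
  shows "(\<Sum>k\<in>{-M..M}. of_real (max 0 (t + of_int k)) * z powi k) =
    green z t + z powi (M + 1) * (of_real (t + of_int (M + 1)) / (z - 1) - z / (z - 1)\<^sup>2)"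
proof -
  define U where "U k = z powi k * (of_real (t + of_int k) / (z - 1) - z / (z - 1)\<^sup>2)" for k :: int
  have step: "of_real (t + of_int k) * z powi k = U (k + 1) - U k" for k
  proof -
    have "U (k + 1) - U k = z powi k * (z * (of_real (t + of_int k + 1) / (z - 1) - z / (z - 1)\<^sup>2) -
        (of_real (t + of_int k) / (z - 1) - z / (z - 1)\<^sup>2))"
      using z by (simp add: U_def power_int_add algebra_simps)
    also have "z * (of_real (t + of_int k + 1) / (z - 1) - z / (z - 1)\<^sup>2) -
        (of_real (t + of_int k) / (z - 1) - z / (z - 1)\<^sup>2) = of_real (t + of_int k)"
    proof -
      define u s where "u = 1 / (z - 1)" and "s = complex_of_real (t + of_int k)"
      have u: "u * (z - 1) = 1" using z(2) by (simp add: u_def)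
      have "z * ((s + 1) * u - z * u\<^sup>2) - (s * u - z * u\<^sup>2) = s * (u * (z - 1)) + z * u * (1 - u * (z - 1))"
        by (simp add: algebra_simps power2_eq_square)
      then show ?thesis
        unfolding u by (simp add: u_def s_def power_one_over divide_inverse power_inverse)
    qed
    finally show ?thesis by simp
  qed
  have telescope: "(\<Sum>k\<in>{a..<a + int n}. U (k + 1) - U k) = U (a + int n) - U a" for a n
  proof (induction n)
    case (Suc n)
    have "{a..<a + int (Suc n)} = insert (a + int n) {a..<a + int n}" by auto
    with Suc show ?case by (simp add: add_ac)
  qed simp
  have fl: "- M \<le> - \<lfloor>t\<rfloor>" "- \<lfloor>t\<rfloor> \<le> M + 1" using t by linarith+
  have "(\<Sum>k\<in>{-M..M}. of_real (max 0 (t + of_int k)) * z powi k) =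
      (\<Sum>k\<in>{- \<lfloor>t\<rfloor>..<- \<lfloor>t\<rfloor> + int (nat (M + 1 + \<lfloor>t\<rfloor>))}. U (k + 1) - U k)"
  proof (rule sum.mono_neutral_cong_right)
    show "\<forall>k\<in>{-M..M} - {- \<lfloor>t\<rfloor>..<- \<lfloor>t\<rfloor> + int (nat (M + 1 + \<lfloor>t\<rfloor>))}. of_real (max 0 (t + of_int k)) * z powi k = 0"
    proof
      fix k assume "k \<in> {-M..M} - {- \<lfloor>t\<rfloor>..<- \<lfloor>t\<rfloor> + int (nat (M + 1 + \<lfloor>t\<rfloor>))}"
      then have "k < - \<lfloor>t\<rfloor>" using fl by auto
      then have "t + of_int k \<le> 0" by linarith
      then show "of_real (max 0 (t + of_int k)) * z powi k = 0" by simp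
    qed
    fix k assume "k \<in> {- \<lfloor>t\<rfloor>..<- \<lfloor>t\<rfloor> + int (nat (M + 1 + \<lfloor>t\<rfloor>))}"
    then have "- \<lfloor>t\<rfloor> \<le> k" by simp
    then have "max 0 (t + of_int k) = t + of_int k" by (simp add: max_def) linarith
    then show "of_real (max 0 (t + of_int k)) * z powi k = U (k + 1) - U k"
      by (simp only: step)
  qed (use fl in auto)
  also have "\<dots> = U (M + 1) - U (- \<lfloor>t\<rfloor>)"
    unfolding telescope using fl by simp
  also have "U (- \<lfloor>t\<rfloor>) = - green z t"
  proof -
    have 1: "(z - 1)\<^sup>2 = (1 - z)\<^sup>2" by (rule power2_commute)
    have 2: "of_real (frac t) / (z - 1) = - (of_real (frac t) / (1 - z))"
      by (metis minus_diff_eq minus_divide_right)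
    have 3: "t + of_int (- \<lfloor>t\<rfloor>) = frac t" by (simp add: frac_def)
    show ?thesis unfolding U_def green_def 1 2 3 by (simp add: algebra_simps)
  qed
  finally show ?thesis by (simp add: U_def)
qed

text \<open>
  The tent \<open>max 0 (b - \<bar>y\<bar>)\<close> is the second difference with step \<open>b\<close> of the ramp \<open>max 0\<close>, so its Zak
  transform is the same second difference of \<open>green z\<close>.
\<close>

definition tent_zak :: "real \<Rightarrow> complex \<Rightarrow> real \<Rightarrow> complex" where
  "tent_zak b z y = green z (y + b) - 2 * green z y + green z (y - b)"

lemma tent_zak_add_int:
  "z \<noteq> 0 \<Longrightarrow> tent_zak b z (y + of_int n) = z powi (- n) * tent_zak b z y"
  using green_add_int[of z "y + b" n] green_add_int[of z y n] green_add_int[of z "y - b" n]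
  by (simp add: tent_zak_def algebra_simps)

lemma tent_sum:
  assumes z: "z \<noteq> 0" "z \<noteq> 1" and b: "b > 0" and M: "\<bar>y\<bar> + b \<le> of_int M"
  shows "(\<Sum>k\<in>{-M..M}. of_real (max 0 (b - \<bar>y + of_int k\<bar>)) * z powi k) = tent_zak b z y"
proof -
  have tent: "max 0 (b - \<bar>x\<bar>) = max 0 (x + b) - 2 * max 0 x + max 0 (x - b)" for x
    using b by (auto simp: max_def abs_if)
  have "of_real (max 0 (b - \<bar>y + of_int k\<bar>)) * z powi k =
     of_real (max 0 ((y + b) + of_int k)) * z powi k - 2 * (of_real (max 0 (y + of_int k)) * z powi k)
     + of_real (max 0 ((y - b) + of_int k)) * z powi k" for k
  proof -
    have "(y + of_int k) + b = (y + b) + of_int k" "(y + of_int k) - b = (y - b) + of_int k" by simp_all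
    then show ?thesis
      by (simp only: tent of_real_add of_real_diff of_real_mult) (simp add: algebra_simps)
  qed
  then have "(\<Sum>k\<in>{-M..M}. of_real (max 0 (b - \<bar>y + of_int k\<bar>)) * z powi k) =
     (\<Sum>k\<in>{-M..M}. of_real (max 0 ((y + b) + of_int k)) * z powi k)
     - 2 * (\<Sum>k\<in>{-M..M}. of_real (max 0 (y + of_int k)) * z powi k)
     + (\<Sum>k\<in>{-M..M}. of_real (max 0 ((y - b) + of_int k)) * z powi k)"
    by (simp only: sum_distrib_left sum.distrib sum_subtractf)
  also have "\<dots> = tent_zak b z y"
  proof -
    have "\<bar>y + b\<bar> \<le> of_int M" "\<bar>y\<bar> \<le> of_int M" "\<bar>y - b\<bar> \<le> of_int M" using b M by linarith+
    note sums = this[THEN green_sum[OF z]]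
    show ?thesis
      unfolding sums tent_zak_def
      by (simp add: algebra_simps add_divide_distrib diff_divide_distrib)
  qed
  finally show ?thesis .
qed

lemma signed_frac_bound: "\<bar>signed_frac b\<bar> \<le> 1 / 2"
  using of_int_round_abs_le[of b] by (simp add: signed_frac_def abs_minus_commute)

text \<open>
  Only the distance \<open>\<delta>\<close> of \<open>b\<close> to the nearest integer enters the piecewise linear function, the integer
  part being absorbed into the unimodular factor \<open>w\<close>.
\<close>

lemma tent_zak_reduced:
  assumes z: "norm z = 1"
  obtains w where "norm w = 1" "w = 1 \<longleftrightarrow> z powi (round b) = 1"
    "\<And>y. tent_zak b z y = cnj w * green z (y + \<bar>signed_frac b\<bar>) - 2 * green z y + w * green z (y - \<bar>signed_frac b\<bar>)"
proof -
  define N where "N = round b"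
  have z0: "z \<noteq> 0" using z by auto
  have norm_pow: "norm (z powi n) = 1" for n by (simp add: norm_power_int z)
  have cnj_pow: "cnj (z powi n) = z powi (- n)" for n
  proof -
    have "z powi n * cnj (z powi n) = 1"
      using complex_norm_square[of "z powi n"] norm_pow[of n] by simp
    then show ?thesis using z0 by (simp add: power_int_minus field_simps)
  qed
  show thesis
  proof (cases "signed_frac b \<ge> 0")
    case True
    then have "y + b = (y + \<bar>signed_frac b\<bar>) + of_int N" "y - b = (y - \<bar>signed_frac b\<bar>) + of_int (- N)" for y
      by (simp_all add: signed_frac_def N_def)
    then have "tent_zak b z y = cnj (z powi N) * green z (y + \<bar>signed_frac b\<bar>) - 2 * green z y + z powi N * green z (y - \<bar>signed_frac b\<bar>)" for y
      unfolding tent_zak_def by (simp only: green_add_int[OF z0] cnj_pow) simp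
    then show thesis
      by (intro that[of "z powi N"]) (simp_all add: norm_pow N_def)
  next
    case False
    then have "y + b = (y - \<bar>signed_frac b\<bar>) + of_int N" "y - b = (y + \<bar>signed_frac b\<bar>) + of_int (- N)" for y
      by (simp_all add: signed_frac_def N_def)
    then have "tent_zak b z y = cnj (z powi (- N)) * green z (y + \<bar>signed_frac b\<bar>) - 2 * green z y + z powi (- N) * green z (y - \<bar>signed_frac b\<bar>)" for y
      unfolding tent_zak_def by (simp only: green_add_int[OF z0] cnj_pow) simp
    then show thesis
      by (intro that[of "z powi (- N)"]) (simp_all add: N_def power_int_minus norm_inverse norm_power_int z)
  qed
qed

text \<open>
  The substitution \<open>1 / (1 - z) = 1/2 + \<i>\<tau>\<close> parametrises the circle without \<open>1\<close> by the line and makes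
  the affine pieces of \<open>green z\<close> polynomial in \<open>\<tau>\<close>.
\<close>

lemma unit_circle_inverse:
  assumes "norm z = 1" "z \<noteq> 1"
  obtains \<tau> where "1 / (1 - z) = Complex (1/2) \<tau>"
proof -
  have "Re (1 / (1 - z)) = 1 / 2"
  proof -
    have "(Re z)\<^sup>2 + (Im z)\<^sup>2 = 1"
      using assms(1) by (simp add: cmod_def)
    then have "(1 - Re z)\<^sup>2 + (Im z)\<^sup>2 = 2 * (1 - Re z)" by (simp add: power2_eq_square algebra_simps)
    moreover have "Re z \<noteq> 1"
    proof
      assume "Re z = 1"
      then have "z = 1" using \<open>(Re z)\<^sup>2 + (Im z)\<^sup>2 = 1\<close> by (simp add: complex_eq_iff)
      then show False using assms(2) by simp
    qed
    ultimately show ?thesis by (simp add: Re_divide)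
  qed
  then show thesis by (intro that[of "Im (1 / (1 - z))"]) (simp add: complex_eq_iff)
qed

lemma green_affine:
  assumes "norm z = 1" "z \<noteq> 1" and B: "1 / (1 - z) = B"
  shows "0 \<le> t \<Longrightarrow> t \<le> 1 \<Longrightarrow> green z t = B * (B - 1) + of_real t * B"
    and "-1 \<le> t \<Longrightarrow> t \<le> 0 \<Longrightarrow> green z t = B * (B - 1) + of_real t * (B - 1)"
proof -
  have z0: "z \<noteq> 0" using assms(1) by auto
  have B1: "B * (1 - z) = 1" using B assms(2) by (auto simp: field_simps)
  have zB: "z * B = B - 1" using B1 by (simp add: algebra_simps)
  have A: "z / (1 - z)\<^sup>2 = B * (B - 1)"
  proof -
    have "z / (1 - z)\<^sup>2 = (z * (1 / (1 - z))) * (1 / (1 - z))"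
      by (simp add: power2_eq_square)
    then show ?thesis unfolding B zB by (simp add: mult.commute)
  qed
  have inner: "green z t = B * (B - 1) + of_real t * B" if "0 \<le> t" "t < 1" for t
  proof -
    have "\<lfloor>t\<rfloor> = 0" using that by (simp add: floor_eq_iff)
    then have "green z t = B * (B - 1) + of_real t * (1 / (1 - z))"
      by (simp add: green_def frac_def A)
    then show ?thesis unfolding B .
  qed
  have one: "green z 1 = B * (B - 1) + B"
  proof -
    have "z * green z 1 = green z 0"
      using green_add_int[OF z0, of 0 1] z0 by (simp add: power_int_minus)
    also have "\<dots> = z * (B * (B - 1) + B)"
    proof -
      have "z * (B * (B - 1) + B) = z * B * B" by (simp add: algebra_simps)
      then show ?thesis unfolding zB using inner[of 0] by (simp add: mult.commute)
    qed
    finally show ?thesis using z0 by simp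
  qed
  show pos: "green z t = B * (B - 1) + of_real t * B" if "0 \<le> t" "t \<le> 1" for t
    using inner[of t] one that by (cases "t = 1") auto
  show "green z t = B * (B - 1) + of_real t * (B - 1)" if "-1 \<le> t" "t \<le> 0" for t
  proof -
    have "green z t = z * green z (t + 1)"
      using green_add_int[OF z0, of t 1] z0 by (simp add: power_int_minus)
    also have "green z (t + 1) = B * (B - 1) + of_real (t + 1) * B"
      by (rule pos) (use that in auto)
    also have "z * \<dots> = (z * B) * (B - 1) + of_real (t + 1) * (z * B)"
      by (simp add: algebra_simps)
    also have "\<dots> = B * (B - 1) + of_real t * (B - 1)"
      unfolding zB by (simp add: algebra_simps)
    finally show ?thesis .
  qed
qed


text \<open>The value at the origin, which is real because the tent is even.\<close>

definition tent_peak :: "real \<Rightarrow> real \<Rightarrow> real \<Rightarrow> real \<Rightarrow> real" where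
  "tent_peak \<tau> c s \<delta> = 2 * (1 - c) * (1/4 + \<tau>\<^sup>2) + \<delta> * (c + 2 * \<tau> * s)"

text \<open>
  On a period the Zak transform of a tent has kinks only at \<open>0\<close> and \<open>\<plusminus>\<delta>\<close>. In real coordinates the
  outer piece and the two inner pieces become simple enough to read off their zeros.
\<close>

context
  fixes z w :: complex and \<tau> c s \<delta> :: real and V :: "real \<Rightarrow> complex"
  assumes z: "norm z = 1" "z \<noteq> 1" "1 / (1 - z) = Complex (1/2) \<tau>"
    and w: "w = Complex c s" "c\<^sup>2 + s\<^sup>2 = 1"
    and \<delta>: "0 \<le> \<delta>" "\<delta> \<le> 1 / 2"
    and V: "\<And>y. V y = cnj w * green z (y + \<delta>) - 2 * green z y + w * green z (y - \<delta>)"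
begin

lemma tent_outer:
  assumes "\<delta> \<le> y" "y \<le> 1 - \<delta>"
  shows "V y = Complex (1/2) \<tau> * Complex (2 * (c - 1) * (y - 1/2)) (2 * (c - 1) * \<tau> - 2 * \<delta> * s)"
proof -
  note g = green_affine(1)[OF z(1,2,3)]
  have "V y = cnj w * (Complex (1/2) \<tau> * (Complex (1/2) \<tau> - 1) + of_real (y + \<delta>) * Complex (1/2) \<tau>)
      - 2 * (Complex (1/2) \<tau> * (Complex (1/2) \<tau> - 1) + of_real y * Complex (1/2) \<tau>)
      + w * (Complex (1/2) \<tau> * (Complex (1/2) \<tau> - 1) + of_real (y - \<delta>) * Complex (1/2) \<tau>)"
    unfolding V using assms \<delta> by (simp add: g)
  then show ?thesis
    unfolding w(1) by (simp add: complex_eq_iff algebra_simps)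
qed

lemma tent_inner:
  assumes "\<bar>y\<bar> \<le> \<delta>"
  shows "V y = Complex (tent_peak \<tau> c s \<delta> - \<bar>y\<bar>) (2 * y * (\<tau> * c - s / 2 - \<tau>))"
proof (cases "y \<ge> 0")
  case True
  note g = green_affine[OF z(1,2,3)]
  have "V y = cnj w * (Complex (1/2) \<tau> * (Complex (1/2) \<tau> - 1) + of_real (y + \<delta>) * Complex (1/2) \<tau>)
      - 2 * (Complex (1/2) \<tau> * (Complex (1/2) \<tau> - 1) + of_real y * Complex (1/2) \<tau>)
      + w * (Complex (1/2) \<tau> * (Complex (1/2) \<tau> - 1) + of_real (y - \<delta>) * (Complex (1/2) \<tau> - 1))"
    unfolding V using assms \<delta> True by (simp add: g)
  then show ?thesis
    unfolding w(1) tent_peak_def using True by (simp add: complex_eq_iff algebra_simps power2_eq_square)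
next
  case False
  note g = green_affine[OF z(1,2,3)]
  have "V y = cnj w * (Complex (1/2) \<tau> * (Complex (1/2) \<tau> - 1) + of_real (y + \<delta>) * Complex (1/2) \<tau>)
      - 2 * (Complex (1/2) \<tau> * (Complex (1/2) \<tau> - 1) + of_real y * (Complex (1/2) \<tau> - 1))
      + w * (Complex (1/2) \<tau> * (Complex (1/2) \<tau> - 1) + of_real (y - \<delta>) * (Complex (1/2) \<tau> - 1))"
    unfolding V using assms \<delta> False by (simp add: g)
  then show ?thesis
    unfolding w(1) tent_peak_def using False by (simp add: complex_eq_iff algebra_simps power2_eq_square)
qed

text \<open>
  Unless \<open>w = 1\<close>, all zeros are half-integers: on the outer piece the real factor vanishes only at
  \<open>1 / 2\<close>, and a zero \<open>y \<noteq> 0\<close> on an inner piece forces \<open>w\<close> to be the conjugate of \<open>z\<close>, in which case the peak is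
  \<open>1 - \<delta>\<close> and the linear decay cannot reach \<open>0\<close> before \<open>\<bar>y\<bar> = \<delta> = 1 / 2\<close>.
\<close>

lemma tent_zero_half:
  assumes "c < 1" "\<bar>y\<bar> \<le> 1 / 2" "V y = 0" and shift: "V (y + 1) = 0 \<longleftrightarrow> V y = 0"
  shows "y = 0 \<or> \<bar>y\<bar> = 1 / 2"
proof (cases "\<bar>y\<bar> \<le> \<delta>")
  case True
  with assms(3) have y: "tent_peak \<tau> c s \<delta> = \<bar>y\<bar>" "y * (\<tau> * c - s / 2 - \<tau>) = 0"
    by (simp_all add: tent_inner complex_eq_iff)
  show ?thesis
  proof (cases "y = 0")
    case False
    with y(2) have "\<tau> * c - s / 2 - \<tau> = 0" by simp
    then have e: "(1 - c) * \<tau> = - s / 2" by (simp add: algebra_simps)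
    have "(1 - c) * (s * \<tau>) = s * ((1 - c) * \<tau>)" by simp
    also have "\<dots> = - s\<^sup>2 / 2" unfolding e by (simp add: power2_eq_square)
    also have "\<dots> = (1 - c) * (- (1 + c) / 2)" using w(2) by (simp add: power2_eq_square algebra_simps)
    finally have st: "s * \<tau> = - (1 + c) / 2" using assms(1) by simp
    have "tent_peak \<tau> c s \<delta> = (1 - c) / 2 + 2 * \<tau> * ((1 - c) * \<tau>) + \<delta> * (c + 2 * (s * \<tau>))"
      by (simp add: tent_peak_def power2_eq_square field_simps)
    also have "\<dots> = (1 - c) / 2 - s * \<tau> + \<delta> * (c + 2 * (s * \<tau>))"
      unfolding e by (simp add: algebra_simps)
    also have "\<dots> = 1 - \<delta>"
      unfolding st by (simp add: field_simps)
    finally show ?thesis using y(1) True \<delta> by linarith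
  qed simp
next
  case False
  define y' where "y' = (if y \<ge> 0 then y else y + 1)"
  have "\<delta> \<le> y'" "y' \<le> 1 - \<delta>" "V y' = 0"
    using False assms(2,3) shift by (auto simp: y'_def abs_if split: if_splits)
  then have "2 * (c - 1) * (y' - 1/2) = 0"
    by (simp add: tent_outer complex_eq_iff[of "Complex _ _"] flip: zero_complex.code)
  then have "y' = 1 / 2" using assms(1) by simp
  then show ?thesis by (auto simp: y'_def split: if_splits)
qed

text \<open>A zero at \<open>1 / 2\<close> fixes \<open>\<tau>\<close>, and with this value the peak is a positive number.\<close>

lemma tent_not_both_zero:
  assumes "c < 1" "V 0 = 0" "V (1/2) = 0"
  shows False
proof -
  have "tent_peak \<tau> c s \<delta> = 0" using tent_inner[of 0] assms(2) \<delta> by (simp add: complex_eq_iff)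
  moreover have "Complex (1/2) \<tau> \<noteq> 0" by (simp add: complex_eq_iff)
  then have "2 * (c - 1) * \<tau> - 2 * \<delta> * s = 0"
    using tent_outer[of "1/2"] assms(3) \<delta> by (simp add: complex_eq_iff[of "Complex 0 _"])
  then have e: "(c - 1) * \<tau> = \<delta> * s" by (simp add: algebra_simps)
  have "tent_peak \<tau> c s \<delta> = (1 - c) / 2 - 2 * \<tau> * ((c - 1) * \<tau>) + \<delta> * (c + 2 * \<tau> * s)"
    by (simp add: tent_peak_def power2_eq_square field_simps)
  then have "tent_peak \<tau> c s \<delta> = (1 - c) / 2 + \<delta> * c"
    unfolding e by (simp add: algebra_simps)
  moreover have "(1 - c) / 2 + \<delta> * c > 0"
  proof -
    have "(1 - c) / 2 + \<delta> * c = (1 - c) * (1/2 - \<delta>) + \<delta>" by (simp add: algebra_simps)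
    moreover have "(1 - c) * (1/2 - \<delta>) \<ge> 0" using assms(1) \<delta> by simp
    moreover have "(1 - c) * (1/2 - \<delta>) > 0 \<or> \<delta> > 0"
      using \<delta> assms(1) by (cases "\<delta> = 0") auto
    ultimately show ?thesis using \<delta>(1) by linarith
  qed
  ultimately show False by simp
qed

end

section \<open>Common zeros for the tent window\<close>

locale tent_window =
  fixes b :: real and q :: int
  assumes b_pos: "b > 0" and q_ge_2: "q \<ge> 2"
begin

sublocale gabor_window "\<lambda>x. B2 (x / b)" "\<lceil>b\<rceil>" q
proof
  show "continuous_on UNIV (\<lambda>x. B2 (x / b))"
    unfolding B2_eq using b_pos by (intro continuous_intros) auto
  show "B2 (x / b) = 0" if "\<bar>x\<bar> \<ge> of_int \<lceil>b\<rceil>" for x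
  proof -
    have "\<bar>x\<bar> \<ge> b" using that by linarith
    then show ?thesis using b_pos by (simp add: B2_eq)
  qed
  show "\<lceil>b\<rceil> > 0" "q > 0" using b_pos q_ge_2 by simp_all
qed

lemma scaled_tent: "b * B2 (x / b) = max 0 (b - \<bar>x\<bar>)"
proof -
  have "b * (1 - \<bar>x / b\<bar>) = b - \<bar>x\<bar>" using b_pos by (simp add: algebra_simps)
  then show ?thesis using b_pos by (simp add: B2_eq max_mult_distrib_left)
qed

lemma scaled_tent_nonzero_iff: "B2 (x / b) \<noteq> 0 \<longleftrightarrow> \<bar>x\<bar> < b"
  using scaled_tent[of x] b_pos by (cases "\<bar>x\<bar> < b") auto

lemma zak_eq_tent_zak:
  assumes "fchar 1 t \<noteq> 1"
  shows "of_real b * zak y t = tent_zak b (fchar 1 t) y"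
proof -
  define M where "M = \<lceil>\<bar>y\<bar> + b\<rceil>"
  have "zak y t = (\<Sum>k\<in>{-M..M}. of_real (B2 ((y + of_int k) / b)) * fchar k t)"
  proof (rule zak_eq_sum)
    fix k assume "B2 ((y + of_int k) / b) \<noteq> 0"
    then have "\<bar>y + of_int k\<bar> < b" by (simp only: scaled_tent_nonzero_iff)
    then show "k \<in> {-M..M}" by (auto simp: M_def) linarith+
  qed simp
  then have "of_real b * zak y t = (\<Sum>k\<in>{-M..M}. of_real (b * B2 ((y + of_int k) / b)) * fchar k t)"
    by (simp add: sum_distrib_left mult.assoc)
  also have "\<dots> = (\<Sum>k\<in>{-M..M}. of_real (max 0 (b - \<bar>y + of_int k\<bar>)) * fchar 1 t powi k)"
    unfolding scaled_tent fchar_powi[symmetric] ..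
  also have "\<dots> = tent_zak b (fchar 1 t) y"
    by (rule tent_sum) (use assms b_pos in \<open>auto simp: M_def\<close>)
  finally show ?thesis .
qed

text \<open>At the trivial character there is no cancellation: the window is non-negative.\<close>

lemma zak_nonzero_at_trivial_character:
  assumes "fchar 1 t = 1" "\<bar>y\<bar> < b"
  shows "zak y t \<noteq> 0"
proof -
  have "zak y t = of_real (\<Sum>k | B2 ((y + of_int k) / b) \<noteq> 0. B2 ((y + of_int k) / b))"
    unfolding zak_def using fchar_powi[of _ t] assms(1) by simp
  moreover have "(\<Sum>k | B2 ((y + of_int k) / b) \<noteq> 0. B2 ((y + of_int k) / b)) > 0"
  proof (rule sum_pos2[of _ 0])
    have "k \<in> {- \<lceil>\<bar>y\<bar> + b\<rceil>..\<lceil>\<bar>y\<bar> + b\<rceil>}" if "B2 ((y + of_int k) / b) \<noteq> 0" for k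
    proof -
      have "\<bar>y + of_int k\<bar> < b"
        using that by (simp only: scaled_tent_nonzero_iff)
      then show ?thesis by auto linarith+
    qed
    then have "{k. B2 ((y + of_int k) / b) \<noteq> 0} \<subseteq> {- \<lceil>\<bar>y\<bar> + b\<rceil>..\<lceil>\<bar>y\<bar> + b\<rceil>}" by blast
    then show "finite {k. B2 ((y + of_int k) / b) \<noteq> 0}" by (rule finite_subset) simp
    have "B2 (y / b) \<noteq> 0" using assms(2) by (simp only: scaled_tent_nonzero_iff)
    moreover have "B2 (y / b) \<ge> 0" by (simp add: B2_eq)
    ultimately show "0 \<in> {k. B2 ((y + of_int k) / b) \<noteq> 0}" "0 < B2 ((y + of_int 0) / b)"
      by auto
  qed (simp add: B2_eq)
  ultimately show ?thesis by (simp del: of_real_sum)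
qed

lemma half_step: "0 < 1 / (2 * real_of_int q)" "1 / (2 * real_of_int q) \<le> 1 / 4"
  using q_ge_2 by (simp_all add: field_simps)

lemma round_nonneg: "round b \<ge> 0"
  using b_pos by (simp add: round_def)

text \<open>
  Unless \<open>round b = 1\<close>, some \<open>z \<noteq> 1\<close> satisfies \<open>z powi round b = 1\<close>. For it the two kinks at \<open>\<plusminus>\<delta>\<close> and the
  one at \<open>0\<close> balance, and the Zak transform vanishes on the whole outer piece. If the inner interval has
  length at most \<open>1 / q\<close>, the coset of \<open>1 / (2q)\<close> avoids its interior.
\<close>

lemma zak_vanishing_if:
  assumes "round b \<noteq> 1" "\<bar>signed_frac b\<bar> \<le> 1 / (2 * of_int q)"
  shows "\<not> zak_nonvanishing"
proof -
  define N where "N = round b"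
  \<comment> \<open>For \<open>N = 0\<close> every \<open>z\<close> satisfies \<open>z powi N = 1\<close>, and \<open>t = 1 / 2\<close> gives \<open>z = -1\<close>.\<close>
  define t where "t = (if N = 0 then 1 / 2 else 1 / real_of_int N)"
  define z where "z = fchar 1 t"
  have N: "N = 0 \<or> N \<ge> 2" using assms(1) round_nonneg by (auto simp: N_def)
  then have t: "0 < t" "t < 1" by (auto simp: t_def)
  have zN: "z powi N = 1"
  proof (cases "N = 0")
    case False
    then have "fchar N t = cis (2 * pi)" by (simp add: fchar_def t_def)
    then show ?thesis by (simp add: z_def flip: fchar_powi)
  qed simp
  have z1: "z \<noteq> 1"
  proof
    assume "z = 1"
    then have "cos (2 * pi * t) = 1"
      by (simp add: z_def fchar_def complex_eq_iff)
    then obtain n :: int where "2 * pi * t = of_int n * (2 * pi)"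
      unfolding cos_one_2pi_int by (auto simp: mult_ac)
    then have "t = of_int n" by simp
    then show False using t by simp
  qed
  have nz: "norm z = 1" by (simp add: z_def)
  obtain w where w: "norm w = 1" "w = 1 \<longleftrightarrow> z powi (round b) = 1"
    "\<And>y. tent_zak b z y = cnj w * green z (y + \<bar>signed_frac b\<bar>) - 2 * green z y + w * green z (y - \<bar>signed_frac b\<bar>)"
    using tent_zak_reduced[OF nz] by blast
  have w1: "w = Complex 1 0" using w(2) zN by (simp add: N_def complex_eq_iff)
  obtain \<tau> where \<tau>: "1 / (1 - z) = Complex (1/2) \<tau>" using unit_circle_inverse[OF nz z1] by blast
  have outer: "zak v t = 0" if "1 / (2 * of_int q) \<le> v" "v \<le> 1 - 1 / (2 * of_int q)" for v
  proof -
    have "tent_zak b z v = 0"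
      using tent_outer[OF nz z1 \<tau> w1 _ abs_ge_zero signed_frac_bound w(3)] that assms(2)
      by (simp add: complex_eq_iff)
    then show ?thesis using zak_eq_tent_zak[of t v] z1 b_pos by (simp add: z_def)
  qed
  have "zak (1 / (2 * of_int q) + of_int m / of_int q) t = 0" for m :: int
  proof -
    define r where "r = m mod q"
    have r: "0 \<le> r" "r \<le> q - 1" using q_pos by (simp_all add: r_def)
    have "real_of_int m = of_int (m div q) * of_int q + of_int r"
      unfolding r_def by (metis div_mult_mod_eq of_int_add of_int_mult)
    then have "1 / (2 * of_int q) + of_int m / of_int q = (2 * of_int r + 1) / (2 * real_of_int q) + of_int (m div q)"
      using q_pos by (simp add: field_simps)
    moreover have "zak ((2 * of_int r + 1) / (2 * real_of_int q)) t = 0"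
    proof (rule outer)
      show "1 / (2 * of_int q) \<le> (2 * of_int r + 1) / (2 * real_of_int q)"
        using r q_pos by (intro divide_right_mono) auto
      have "(2 * of_int r + 1) / (2 * real_of_int q) \<le> (2 * real_of_int q - 1) / (2 * of_int q)"
        using r q_pos by (intro divide_right_mono) auto
      also have "\<dots> = 1 - 1 / (2 * of_int q)" using q_pos by (simp add: field_simps)
      finally show "(2 * of_int r + 1) / (2 * real_of_int q) \<le> 1 - 1 / (2 * of_int q)" .
    qed
    ultimately show ?thesis by (simp only: zak_add_int) simp
  qed
  then show ?thesis unfolding zak_nonvanishing_def by blast
qed

text \<open>
  Every coset meets \<open>[-1 / (2q), 1 / (2q)]\<close>, which lies inside the support of the window; this settles
  \<open>z = 1\<close>. Let \<open>z \<noteq> 1\<close>. If \<open>w = 1\<close>, which excludes \<open>round b = 1\<close>, the point so found lies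
  strictly inside the tent of height \<open>\<delta>\<close> that remains. If \<open>w \<noteq> 1\<close>, two neighbouring points of the coset are
  zeros only if they are \<open>0\<close> and \<open>1 / 2\<close>, and these are not both zeros.
\<close>

lemma zak_nonvanishing_if:
  assumes "round b = 1 \<or> \<bar>signed_frac b\<bar> > 1 / (2 * of_int q)"
  shows zak_nonvanishing
proof (rule ccontr)
  assume "\<not> zak_nonvanishing"
  then obtain y t where zero: "\<And>m::int. zak (y + of_int m / of_int q) t = 0"
    unfolding zak_nonvanishing_def by blast
  define u where "u = y + of_int (- round (of_int q * y)) / of_int q"
  have u: "\<bar>u\<bar> \<le> 1 / (2 * of_int q)"
  proof -
    have "u = (of_int q * y - of_int (round (of_int q * y))) / of_int q"
      using q_pos by (simp add: u_def field_simps)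
    then have "\<bar>u\<bar> = \<bar>of_int q * y - of_int (round (of_int q * y))\<bar> / of_int q"
      using q_pos by simp
    also have "\<dots> \<le> (1 / 2) / of_int q"
      by (rule divide_right_mono)
        (use q_pos of_int_round_abs_le[of "of_int q * y"] in \<open>simp_all add: abs_minus_commute\<close>)
    finally show ?thesis by simp
  qed
  have u0: "zak u t = 0" unfolding u_def by (rule zero)
  have u1: "zak (u + 1 / of_int q) t = 0"
  proof -
    have "u + 1 / of_int q = y + of_int (- round (of_int q * y) + 1) / of_int q"
      by (simp add: u_def diff_divide_distrib)
    then show ?thesis by (simp only: zero)
  qed
  have "\<bar>u\<bar> < b"
  proof (cases "round b = 0")
    case True
    then show ?thesis using assms u b_pos by (simp add: signed_frac_def)
  next
    case False
    then have "of_int (round b) \<ge> (1::real)" using round_nonneg by simp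
    then have "b \<ge> 1 / 2" using of_int_round_abs_le[of b] by linarith
    then show ?thesis using u half_step by linarith
  qed
  define z where "z = fchar 1 t"
  show False
  proof (cases "z = 1")
    case True
    then show False
      using zak_nonzero_at_trivial_character[of t u] \<open>\<bar>u\<bar> < b\<close> u0 by (simp add: z_def)
  next
    case z1: False
    have nz: "norm z = 1" by (simp add: z_def)
    let ?V = "tent_zak b z"
    have V0: "?V v = 0 \<longleftrightarrow> zak v t = 0" for v
      using zak_eq_tent_zak[of t v] z1 b_pos by (auto simp: z_def)
    obtain w where w: "norm w = 1" "w = 1 \<longleftrightarrow> z powi (round b) = 1"
      "\<And>y. ?V y = cnj w * green z (y + \<bar>signed_frac b\<bar>) - 2 * green z y + w * green z (y - \<bar>signed_frac b\<bar>)"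
      using tent_zak_reduced[OF nz] by blast
    obtain \<tau> where \<tau>: "1 / (1 - z) = Complex (1/2) \<tau>" using unit_circle_inverse[OF nz z1] by blast
    define c s where "c = Re w" and "s = Im w"
    have wc: "w = Complex c s" by (simp add: c_def s_def)
    have cs: "c\<^sup>2 + s\<^sup>2 = 1" using w(1) by (simp add: c_def s_def cmod_def)
    note tent = nz z1 \<tau> wc cs abs_ge_zero signed_frac_bound w(3)
    have "c \<le> 1" using w(1) complex_Re_le_cmod[of w] by (simp add: c_def)
    show False
    proof (cases "c = 1")
      case True
      then have "s = 0" using cs by simp
      with True wc have "w = 1" by (simp add: complex_eq_iff)
      with w(2) z1 assms have "\<bar>signed_frac b\<bar> > 1 / (2 * of_int q)" by auto
      with u have "\<bar>u\<bar> < \<bar>signed_frac b\<bar>" by linarith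
      moreover have "?V u = 0" using u0 V0 by simp
      ultimately show False
        using tent_inner[OF tent, of u] True \<open>s = 0\<close>
        by (simp add: complex_eq_iff tent_peak_def)
    next
      case False
      then have c: "c < 1" using \<open>c \<le> 1\<close> by simp
      have shift: "?V (v + 1) = 0 \<longleftrightarrow> ?V v = 0" for v
      proof -
        have "z \<noteq> 0" using nz by auto
        then show ?thesis using tent_zak_add_int[of z b v 1] by simp
      qed
      have zeros: "v = 0 \<or> \<bar>v\<bar> = 1 / 2" if "\<bar>v\<bar> \<le> 1 / 2" "zak v t = 0" for v
        by (rule tent_zero_half[OF tent c that(1) _ shift]) (use that V0 in simp)
      have "u = 0"
        using zeros[of u] u u0 half_step by linarith
      moreover have q2: "1 / real_of_int q \<le> 1 / 2" "1 / real_of_int q > 0"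
        using q_ge_2 by (simp_all add: field_simps)
      ultimately have "1 / real_of_int q = 1 / 2"
        using zeros[of "1 / of_int q"] u1 by auto
      then show False
        using tent_not_both_zero[OF tent c] u0 u1 \<open>u = 0\<close> V0 by simp
    qed
  qed
qed

end

theorem theorem7p2:
  fixes b :: real and q :: int
  assumes "b > 0" and "q \<ge> 2"
  shows "L2_frame (gabor_system (\<lambda>x. complex_of_real (B2 x)) (1 / (of_int q * b)) b) \<longleftrightarrow>
    (round b = 1 \<or>
     (round b \<in> {0} \<union> {2..} \<and> \<bar>signed_frac b\<bar> > 1 / (2 * of_int q)))"
proof -
  interpret tent_window b q using assms by unfold_locales
  have "L2_frame (gabor_system (\<lambda>x. complex_of_real (B2 x)) (1 / (of_int q * b)) b) \<longleftrightarrow> L2_frame \<phi>"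
    using L2_frame_dilate_iff[of "1 / b" "\<lambda>x. complex_of_real (B2 x)" "1 / (of_int q * b)" b] assms by simp
  also have "\<dots> \<longleftrightarrow> zak_nonvanishing" by (rule frame_iff_zak_nonvanishing)
  also have "\<dots> \<longleftrightarrow> round b = 1 \<or> \<bar>signed_frac b\<bar> > 1 / (2 * of_int q)"
    using zak_vanishing_if zak_nonvanishing_if not_le by blast
  also have "\<dots> \<longleftrightarrow> round b = 1 \<or> (round b \<in> {0} \<union> {2..} \<and> \<bar>signed_frac b\<bar> > 1 / (2 * of_int q))"
    using round_nonneg by auto
  finally show ?thesis .
qed

end
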